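(* There exist universal constants $c_1,c_2,c_3>0$ such that the following holds. Let $n\in\mathbb{N}$, let $k\in\mathbb{N}$ be even, and let $0<p<1$. Let $N=np(1-p)-1$ and assume $k\le c_1\cdot N$. Then $$M(n,k,p)\ \ge\ \frac{c_3}{k}\exp\left(-c_2\cdot\frac{k}{V(N/k)}\right)\tilde M(n,k,p),$$ where $V(a)=\exp\left(\sqrt{\log(a)\,\log\log(a)}\right)$.
   Context: $\mathbb{N}$ denotes the positive integers and $\log$ the natural logarithm. $\mathrm{Bin}(n,p)$ is the Binomial distribution. For $n,k\in\mathbb{N}$ and $0<p<1$, $\mathcal{A}(n,k,p)$ is the set of all probability distributions of $(X_1,\dots,X_n)$ on $\{0,1\}^n$ that are $k$-wise independent with identical marginals $p$, i.e. $\mathbb{P}(X_i=1\ \forall i\in S)=p^{|S|}$ for all $S\subseteq\{1,\dots,n\}$ with $|S|\le k$. Define $$M(n,k,p)=\max_{\mathbb{Q}\in\mathcal{A}(n,k,p)}\mathbb{Q}(X_1=\dots=X_n=1).$$ $\tilde M(n,k,p)$ is defined as the maximum of $\mathbb{P}(S=n)$ over all real random variables $S$ supported on $[0,n]$ with $\mathbb{E}S^i=\mathbb{E}X^i$ for $1\le i\le k$, where $X\sim\mathrm{Bin}(n,p)$. For even $k$ it is known that $$\tilde M(n,k,p)=\frac{p^n}{\mathbb{P}\left(\mathrm{Bin}(n,1-p)\le \frac k2\right)}.$$ *)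

theory Defs
  imports "HOL-Probability.Probability"
begin

definition kwise_indep_laws :: "nat \<Rightarrow> nat \<Rightarrow> real \<Rightarrow> (nat \<Rightarrow> nat) pmf set" where
  "kwise_indep_laws n k p =
    {Q. set_pmf Q \<subseteq> {1..n} \<rightarrow>\<^sub>E {0, 1} \<and>
        (\<forall>S\<subseteq>{1..n}. card S \<le> k \<longrightarrow>
           measure_pmf.prob Q {x. \<forall>i\<in>S. x i = 1} = p ^ card S)}"

(* The supremum is a maximum: see M_attained below. *)
definition M :: "nat \<Rightarrow> nat \<Rightarrow> real \<Rightarrow> real" where
  "M n k p = (SUP Q\<in>kwise_indep_laws n k p. measure_pmf.prob Q {x. \<forall>i\<in>{1..n}. x i = 1})"

(* Both the constraints on S and P(S = n) depend only on the law of S,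
   so the random variables are represented by their laws on the real line. *)
definition moment_matching_laws :: "nat \<Rightarrow> nat \<Rightarrow> real \<Rightarrow> real measure set" where
  "moment_matching_laws n k p =
    {\<mu>. real_distribution \<mu> \<and> (AE s in \<mu>. s \<in> {0..real n}) \<and>
        (\<forall>i\<in>{1..k}. (LINT s|\<mu>. s ^ i) =
           measure_pmf.expectation (binomial_pmf n p) (\<lambda>j. real j ^ i))}"

(* The supremum is a maximum: see M_tilde_attained below. *)
definition M_tilde :: "nat \<Rightarrow> nat \<Rightarrow> real \<Rightarrow> real" where
  "M_tilde n k p = (SUP \<mu>\<in>moment_matching_laws n k p. measure \<mu> {real n})"

(* Meaningful for a >= exp 1, where ln (ln a) >= 0; HOL gives junk values below. *)
definition V :: "real \<Rightarrow> real" where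
  "V a = exp (sqrt (ln a * ln (ln a)))"

lemma prob_eq_sum:
  assumes "finite F" "set_pmf Q \<subseteq> F"
  shows "measure_pmf.prob Q B = (\<Sum>x\<in>F \<inter> B. pmf Q x)"
proof -
  have "measure_pmf.prob Q B = measure_pmf.prob Q (F \<inter> B)"
    using assms(2) by (intro measure_prob_cong_0) (auto simp: set_pmf_iff)
  then show ?thesis using assms(1) by (simp add: measure_measure_pmf_finite)
qed

lemma kwise_indep_laws_nonempty:
  assumes "0 < p" "p < 1"
  shows "kwise_indep_laws n k p \<noteq> {}"
proof -
  define b where "b = map_pmf (of_bool :: bool \<Rightarrow> nat) (bernoulli_pmf p)"
  define Q where "Q = Pi_pmf {1..n} undefined (\<lambda>_. b)"
  have b01: "set_pmf b \<subseteq> {0, 1}" by (auto simp: b_def)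
  have "set_pmf Q \<subseteq> PiE_dflt {1..n} undefined (set_pmf \<circ> (\<lambda>_. b))"
    unfolding Q_def by (rule set_Pi_pmf_subset') simp
  also have "\<dots> \<subseteq> {1..n} \<rightarrow>\<^sub>E {0, 1}"
  proof
    fix x assume x: "x \<in> PiE_dflt {1..n} undefined (set_pmf \<circ> (\<lambda>_. b))"
    show "x \<in> {1..n} \<rightarrow>\<^sub>E {0, 1}"
    proof (rule PiE_I)
      fix i assume "i \<in> {1..n}"
      then have "x i \<in> set_pmf b" using x by (simp add: PiE_dflt_def)
      then show "x i \<in> {0, 1}" using b01 by (rule subsetD[rotated])
    next
      fix i assume "i \<notin> {1..n}"
      then show "x i = undefined" using x unfolding PiE_dflt_def mem_Collect_eq by metis
    qed
  qed
  finally have "set_pmf Q \<subseteq> {1..n} \<rightarrow>\<^sub>E {0, 1}" .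
  moreover have "measure_pmf.prob Q {x. \<forall>i\<in>S. x i = 1} = p ^ card S" if S: "S \<subseteq> {1..n}" for S
  proof -
    have b1: "measure_pmf.prob b {Suc 0} = p"
    proof -
      have v: "(of_bool :: bool \<Rightarrow> nat) -` {Suc 0} = {True}"
        by (auto simp: of_bool_def split: if_splits)
      have "measure_pmf.prob b {Suc 0} = pmf (bernoulli_pmf p) True"
        unfolding b_def measure_map_pmf v by (rule measure_pmf_single)
      also have "\<dots> = p" using assms by (intro pmf_bernoulli_True) auto
      finally show ?thesis .
    qed
    have "measure_pmf.prob Q {x. \<forall>i\<in>S. x i = 1}
        = measure_pmf.prob Q (Pi {1..n} (\<lambda>i. if i \<in> S then {1} else UNIV))"
      using S by (intro arg_cong[where f="measure_pmf.prob Q"]) (auto simp: Pi_def)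
    also have "\<dots> = (\<Prod>i\<in>{1..n}. measure_pmf.prob b (if i \<in> S then {1} else UNIV))"
      unfolding Q_def by (subst measure_Pi_pmf_Pi) auto
    also have "\<dots> = (\<Prod>i\<in>{1..n}. if i \<in> S then p else 1)"
      using b1 by (intro prod.cong) (auto split: if_split)
    also have "\<dots> = p ^ card S"
      using S by (simp add: prod.If_cases Int_absorb1)
    finally show ?thesis .
  qed
  ultimately have "Q \<in> kwise_indep_laws n k p"
    unfolding kwise_indep_laws_def by simp
  then show ?thesis by (rule ex_in_conv[THEN iffD1, OF exI])
qed

lemma M_attained:
  assumes "0 < p" "p < 1"
  shows "\<exists>Q\<in>kwise_indep_laws n k p. measure_pmf.prob Q {x. \<forall>i\<in>{1..n}. x i = 1} = M n k p"
proof -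
  define F :: "(nat \<Rightarrow> nat) set" where "F = {1..n} \<rightarrow>\<^sub>E {0, 1}"
  define E :: "nat set \<Rightarrow> (nat \<Rightarrow> nat) set" where "E S = {x. \<forall>i\<in>S. x i = 1}" for S
  define Box :: "((nat \<Rightarrow> nat) \<Rightarrow> real) set" where
    "Box = PiE UNIV (\<lambda>x. if x \<in> F then {0..1} else {0})"
  define K where "K = Box \<inter> {f. sum f F = 1} \<inter>
    (\<Inter>S\<in>{S. S \<subseteq> {1..n} \<and> card S \<le> k}. {f. (\<Sum>x\<in>F \<inter> E S. f x) = p ^ card S})"
  have finF: "finite F" unfolding F_def by (intro finite_PiE) auto
  have "compact Box"
    using compactin_PiE[of "\<lambda>_. euclidean :: real topology" UNIV "\<lambda>x. if x \<in> F then {0..1} else {0}"]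
    by (simp add: Box_def euclidean_product_topology)
  moreover have cont: "continuous_on UNIV (\<lambda>f. \<Sum>x\<in>B. f x :: real)" for B :: "(nat \<Rightarrow> nat) set"
    by (intro continuous_on_sum continuous_on_product_coordinates)
  have "closed ({f. (\<Sum>x\<in>B. f x) = c})" for B :: "(nat \<Rightarrow> nat) set" and c :: real
    by (intro closed_Collect_eq cont continuous_on_const)
  ultimately have "compact K"
    unfolding K_def Int_assoc by (intro compact_Int_closed closed_Int closed_INT ballI) auto
  have toK: "pmf Q \<in> K" if "Q \<in> kwise_indep_laws n k p" for Q
  proof -
    have sub: "set_pmf Q \<subseteq> F" using that by (auto simp: kwise_indep_laws_def F_def)
    have "pmf Q \<in> Box" using sub by (auto simp: Box_def pmf_le_1 set_pmf_iff)
    then show ?thesis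
      using that prob_eq_sum[OF finF sub] sum_pmf_eq_1[OF finF sub]
      by (simp add: K_def E_def kwise_indep_laws_def)
  qed
  have fromK: "\<exists>Q\<in>kwise_indep_laws n k p. pmf Q = f" if f: "f \<in> K" for f
  proof -
    have nn: "f x \<ge> 0" for x
      using f by (auto simp: K_def Box_def PiE_iff split: if_splits)
    have z: "f x = 0" if "x \<notin> F" for x
      using f that by (auto simp: K_def Box_def PiE_iff dest!: spec[of _ x])
    have "(\<integral>\<^sup>+x. ennreal (f x) \<partial>count_space UNIV) = (\<Sum>x\<in>F. ennreal (f x))"
      using finF z by (intro nn_integral_count_space') auto
    also have "\<dots> = 1" using f nn by (simp add: K_def sum_ennreal)
    finally have pf: "pmf (embed_pmf f) = f" using nn by (intro ext pmf_embed_pmf) auto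
    then have sub: "set_pmf (embed_pmf f) \<subseteq> F" using z by (metis set_pmf_iff subsetI)
    have "embed_pmf f \<in> kwise_indep_laws n k p"
      using f sub prob_eq_sum[OF finF sub] pf
      by (auto simp: kwise_indep_laws_def K_def E_def F_def)
    with pf show ?thesis by blast
  qed
  have "K \<noteq> {}" using kwise_indep_laws_nonempty[OF assms, of n k] toK by blast
  then obtain f where f: "f \<in> K" "\<And>g. g \<in> K \<Longrightarrow> (\<Sum>x\<in>F \<inter> E {1..n}. g x) \<le> (\<Sum>x\<in>F \<inter> E {1..n}. f x)"
    using continuous_attains_sup[OF \<open>compact K\<close> _ continuous_on_subset[OF cont, of K "F \<inter> E {1..n}"]] by blast
  obtain Q where Q: "Q \<in> kwise_indep_laws n k p" "pmf Q = f" using fromK f(1) by blast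
  have prob: "measure_pmf.prob Q' (E {1..n}) = (\<Sum>x\<in>F \<inter> E {1..n}. pmf Q' x)"
    if "Q' \<in> kwise_indep_laws n k p" for Q'
    using that by (intro prob_eq_sum[OF finF]) (auto simp: kwise_indep_laws_def F_def)
  have le: "measure_pmf.prob Q' (E {1..n}) \<le> measure_pmf.prob Q (E {1..n})"
    if "Q' \<in> kwise_indep_laws n k p" for Q'
    unfolding prob[OF that] prob[OF Q(1)] Q(2) by (rule f(2)[OF toK[OF that]])
  have "M n k p = measure_pmf.prob Q (E {1..n})"
    unfolding M_def E_def[symmetric]
  proof (rule cSup_eq_maximum)
    fix y assume "y \<in> (\<lambda>Q'. measure_pmf.prob Q' (E {1..n})) ` kwise_indep_laws n k p"
    then show "y \<le> measure_pmf.prob Q (E {1..n})" using le by blast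
  qed (rule imageI[OF Q(1)])
  then show ?thesis unfolding E_def by (intro bexI[OF _ Q(1)]) (rule sym)
qed

lemma moment_matching_laws_nonempty:
  assumes "0 < p" "p < 1"
  shows "moment_matching_laws n k p \<noteq> {}"
proof -
  define \<mu> where "\<mu> = distr (measure_pmf (binomial_pmf n p)) borel real"
  have "real_distribution \<mu>"
    unfolding \<mu>_def by (rule prob_space.real_distribution_distr) (auto intro: measure_pmf.prob_space_axioms)
  moreover have "AE s in \<mu>. s \<in> {0..real n}"
    using assms unfolding \<mu>_def
    by (subst AE_distr_iff) (auto simp: AE_measure_pmf_iff set_pmf_binomial_eq split: if_splits)
  moreover have "(LINT s|\<mu>. s ^ i) = measure_pmf.expectation (binomial_pmf n p) (\<lambda>j. real j ^ i)" for i
    unfolding \<mu>_def by (subst integral_distr) auto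
  ultimately show ?thesis unfolding moment_matching_laws_def by blast
qed

lemma M_tilde_attained:
  assumes "0 < p" "p < 1"
  shows "\<exists>\<mu>\<in>moment_matching_laws n k p. measure \<mu> {real n} = M_tilde n k p"
proof -
  let ?A = "moment_matching_laws n k p"
  let ?T = "(\<lambda>\<mu>. measure \<mu> {real n}) ` ?A"
  have distA: "real_distribution \<mu>" if "\<mu> \<in> ?A" for \<mu>
    using that by (simp add: moment_matching_laws_def)
  have bdd: "bdd_above ?T"
    using distA by (intro bdd_aboveI[of _ 1])
      (auto simp: real_distribution_def intro: prob_space.prob_le_1)
  have ne: "?T \<noteq> {}" using moment_matching_laws_nonempty[OF assms] by blast
  have "\<exists>\<mu>\<in>?A. M_tilde n k p - 1 / Suc j < measure \<mu> {real n}" for j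
    using less_cSup_iff[OF ne bdd, of "M_tilde n k p - 1 / Suc j"] by (auto simp: M_tilde_def)
  then obtain m where mA: "\<And>j. m j \<in> ?A"
    and m: "\<And>j. M_tilde n k p - 1 / Suc j < measure (m j) {real n}" by metis
  have dm: "real_distribution (m j)" for j using mA distA by blast
  have supp: "AE s in m j. s \<in> {0..real n}" for j
    using mA[of j] by (simp add: moment_matching_laws_def)
  have tight: "tight m"
    unfolding tight_def
  proof (intro conjI allI impI)
    fix \<epsilon> :: real assume "\<epsilon> > 0"
    have "measure (m j) {-1<..real n} > 1 - \<epsilon>" for j
    proof -
      interpret real_distribution "m j" by (rule dm)
      have "prob {-1<..real n} = 1"
        using supp[of j] by (subst prob_eq_1) (auto elim!: eventually_mono)
      then show ?thesis using \<open>\<epsilon> > 0\<close> by simp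
    qed
    moreover have "-1 < real n" by (rule less_le_trans[of _ 0]) auto
    ultimately show "\<exists>a b. a < b \<and> (\<forall>j. measure (m j) {a<..b} > 1 - \<epsilon>)"
      by blast
  qed (auto intro: dm)
  obtain r \<mu> where r: "strict_mono r" and d\<mu>: "real_distribution \<mu>" and w: "weak_conv_m (m \<circ> r) \<mu>"
    using tight_imp_convergent_subsubsequence[OF tight, of id] by (auto simp: strict_mono_def)
  interpret \<mu>: real_distribution \<mu> by (rule d\<mu>)
  have conv: "(\<lambda>j. LINT s|m (r j). f s) \<longlonglongrightarrow> (LINT s|\<mu>. f s)"
    if "\<And>x. isCont f x" "\<And>x. norm (f x) \<le> B" for f :: "real \<Rightarrow> real" and B
    using weak_conv_imp_integral_bdd_continuous_conv[of "m \<circ> r" \<mu> f B] dm d\<mu> w that by simp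
  define c where "c s = max 0 (min (real n) s)" for s :: real
  define g where "g s = min 1 \<bar>s - c s\<bar>" for s :: real
  have cc: "isCont c x" for x unfolding c_def by (intro continuous_intros)
  have gc: "isCont g x" for x
    unfolding g_def using cc by (intro continuous_intros) auto
  have c_id: "c s = s" if "s \<in> {0..real n}" for s using that by (auto simp: c_def)
  have "(LINT s|m (r j). g s) = 0" for j
    by (intro integral_eq_zero_AE eventually_mono[OF supp]) (simp add: g_def c_id)
  moreover have "(\<lambda>j. LINT s|m (r j). g s) \<longlonglongrightarrow> (LINT s|\<mu>. g s)"
    by (rule conv[of _ 1]) (rule gc, simp add: g_def)
  ultimately have g0: "(LINT s|\<mu>. g s) = 0" by (simp add: LIMSEQ_const_iff)
  have gm: "g \<in> borel_measurable \<mu>"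
    using gc by (simp add: borel_measurable_continuous_onI continuous_on_eq_continuous_at)
  have "integrable \<mu> g"
    using gm by (intro \<mu>.integrable_const_bound[where B=1]) (auto simp: g_def)
  then have "AE s in \<mu>. g s = 0"
    using g0 by (subst (asm) integral_nonneg_eq_0_iff_AE) (auto simp: g_def)
  then have supp\<mu>: "AE s in \<mu>. s \<in> {0..real n}"
    by eventually_elim (auto simp: g_def c_def min_def max_def split: if_splits)
  have clip: "(LINT s|\<nu>. s ^ i) = (LINT s|\<nu>. c s ^ i)"
    if "real_distribution \<nu>" "AE s in \<nu>. s \<in> {0..real n}" for \<nu> i
  proof -
    interpret \<nu>: real_distribution \<nu> by (rule that(1))
    have [measurable]: "c \<in> borel_measurable borel"
      using cc by (simp add: borel_measurable_continuous_onI continuous_on_eq_continuous_at)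
    show ?thesis
      by (intro integral_cong_AE eventually_mono[OF that(2)]) (auto simp: c_id)
  qed
  have mom: "(LINT s|\<mu>. s ^ i) = measure_pmf.expectation (binomial_pmf n p) (\<lambda>j. real j ^ i)"
    if "i \<in> {1..k}" for i
  proof -
    have "(\<lambda>j. LINT s|m (r j). c s ^ i) \<longlonglongrightarrow> (LINT s|\<mu>. c s ^ i)"
    proof (rule conv)
      show "isCont (\<lambda>s. c s ^ i) x" for x by (intro isCont_power cc)
      show "norm (c x ^ i) \<le> real n ^ i" for x
        unfolding norm_power by (intro power_mono) (auto simp: c_def)
    qed
    moreover have "(LINT s|m (r j). c s ^ i)
        = measure_pmf.expectation (binomial_pmf n p) (\<lambda>j. real j ^ i)" for j
      using clip[OF dm supp] mA[of "r j"] that by (simp add: moment_matching_laws_def)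
    ultimately show ?thesis using clip[OF d\<mu> supp\<mu>] by (simp add: LIMSEQ_const_iff)
  qed
  have \<mu>A: "\<mu> \<in> ?A" using d\<mu> supp\<mu> mom by (simp add: moment_matching_laws_def)
  define h where "h l s = max 0 (1 - real l * \<bar>s - real n\<bar>)" for l and s :: real
  have hc: "isCont (h l) x" for l x unfolding h_def by (intro continuous_intros)
  have h01: "norm (h l s) \<le> 1" for l s by (auto simp: h_def)
  have hm: "h l \<in> borel_measurable borel" for l
    using hc by (simp add: borel_measurable_continuous_onI continuous_on_eq_continuous_at)
  have ub: "M_tilde n k p \<le> (LINT s|\<mu>. h l s)" for l
  proof (rule LIMSEQ_le[OF _ conv[OF hc h01]])
    have "(\<lambda>j. M_tilde n k p - 1 / Suc j) \<longlonglongrightarrow> M_tilde n k p - 0"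
      by (intro tendsto_diff tendsto_const LIMSEQ_Suc[OF lim_1_over_n])
    from LIMSEQ_subseq_LIMSEQ[OF this r]
    show "(\<lambda>j. M_tilde n k p - 1 / Suc (r j)) \<longlonglongrightarrow> M_tilde n k p"
      by (simp add: o_def)
    have "measure (m j) {real n} \<le> (LINT s|m j. h l s)" for j
    proof -
      interpret mj: real_distribution "m j" by (rule dm)
      have "mj.prob {real n} = (LINT s|m j. indicator {real n} s)" by simp
      also have "\<dots> \<le> (LINT s|m j. h l s)"
        using h01 hm
        by (intro integral_mono mj.integrable_const_bound[where B=1])
          (auto simp: h_def indicator_def)
      finally show ?thesis .
    qed
    then show "\<exists>N. \<forall>j\<ge>N. M_tilde n k p - 1 / Suc (r j) \<le> (LINT s|m (r j). h l s)"
      using m by (intro exI[of _ 0] allI impI order_trans[OF less_imp_le[OF m]])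
  qed
  have "(\<lambda>l. LINT s|\<mu>. h l s) \<longlonglongrightarrow> (LINT s|\<mu>. indicator {real n} s)"
  proof (rule integral_dominated_convergence[where w="\<lambda>_. 1"])
    show "AE s in \<mu>. (\<lambda>l. h l s) \<longlonglongrightarrow> indicator {real n} s"
    proof (intro AE_I2)
      fix s :: real
      show "(\<lambda>l. h l s) \<longlonglongrightarrow> indicator {real n} s"
      proof (cases "s = real n")
        case False
        then obtain L where L: "1 < real L * \<bar>s - real n\<bar>"
          using ex_less_of_nat_mult[of "\<bar>s - real n\<bar>" 1] by auto
        have "h l s = 0" if "l \<ge> L" for l
        proof -
          have "real L * \<bar>s - real n\<bar> \<le> real l * \<bar>s - real n\<bar>" using that by (intro mult_right_mono) auto
          with L show ?thesis by (simp add: h_def)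
        qed
        then have "\<forall>\<^sub>F l in sequentially. h l s = indicator {real n} s"
          using False by (intro eventually_sequentiallyI[of L]) simp
        then show ?thesis by (rule tendsto_eventually)
      qed (simp add: h_def)
    qed
  qed (use hm h01 in auto)
  then have "M_tilde n k p \<le> measure \<mu> {real n}"
    using ub by (intro LIMSEQ_le_const) auto
  moreover have "measure \<mu> {real n} \<le> M_tilde n k p"
    unfolding M_tilde_def using \<mu>A bdd by (intro cSup_upper) auto
  ultimately have "measure \<mu> {real n} = M_tilde n k p" by (intro antisym)
  then show ?thesis using \<mu>A by (rule bexI)
qed

end

theory Submission
  imports Defs "HOL-Computational_Algebra.Polynomial"
begin

text \<open>
Write \<open>E P\<close> for the expectation of \<open>P(X)\<close> with \<open>X\<close> binomial, \<open>v = n p (1 - p)\<close> for the variance and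
\<open>h = (v / k) powr (1 / 8)\<close>. Both maxima are values of linear programs, and both are compared through
their duals. The value \<open>M\<close> is the least \<open>E P / P(n)\<close> over polynomials \<open>P\<close> of degree at most \<open>k\<close> that
are nonnegative on the integers \<open>0, \<dots>, n\<close> (\<open>M_ge_if_dual_bound\<close>), while \<open>M_tilde\<close> is at most
\<open>E Q / Q(n)\<close> for every \<open>Q\<close> of degree at most \<open>k\<close> that is nonnegative on the whole interval \<open>[0, n]\<close>
(\<open>M_tilde_mult_le_expectation\<close>). It therefore suffices to turn each \<open>P\<close> into such a \<open>Q\<close> with
\<open>Q(n) \<ge> P(n)\<close> and \<open>E Q\<close> not much larger than \<open>E P\<close>.

On \<open>[0, n]\<close> such a \<open>P\<close> can be negative only strictly between two consecutive integers, so the roots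
responsible for sign changes come in pairs \<open>z - d, z + d\<close> with \<open>d \<le> 1 / 2\<close> and no integer strictly between them
(\<open>nonneg_on_integers_factorization\<close>). The polynomial \<open>Q\<close> is obtained by merging every pair into a
double root: \<open>(x - z)\<^sup>2 - d\<^sup>2\<close> becomes \<open>(x - z)\<^sup>2\<close>. This only increases the values at
integers, and at an integer at distance at least \<open>h\<close> from all the \<open>z\<close> it costs at most a factor
\<open>exp (k / h)\<close>. The values of \<open>P\<close> and \<open>Q\<close> cannot be compared on the exceptional set \<open>B\<close> of integers
within \<open>h\<close> of some \<open>z\<close>, where \<open>P\<close> may vanish. But \<open>B\<close> has only about \<open>k h\<close> elements, which is
much less than the scale \<open>sqrt (k v) = k h\<^sup>4\<close> on which a polynomial of degree \<open>k\<close> sees the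
binomial weights. The heart of the proof is a weighted Remez inequality, \<open>binomial_remez\<close>:
the part of \<open>E Q\<close> carried by \<open>B\<close> is at most \<open>O(k exp (O(k / h)))\<close> times the part carried by
the complement of \<open>B\<close>.

The Remez inequality comes from Lagrange interpolation. For \<open>x\<close> in \<open>B\<close> within \<open>20 k h\<^sup>4\<close> of the mean,
\<open>Q(x)\<close> is interpolated from about \<open>k / 2\<close> points of the complement of \<open>B\<close> on each side of \<open>x\<close>, spaced
by about \<open>h\<^sup>3\<close>. Interpolation at the centre of nearly equidistant nodes is stable, and the binomial
weights vary by at most \<open>exp (O(k / h))\<close> over the nodes (\<open>bulk_point_bound\<close>). For \<open>x\<close> farther out all the
nodes are taken on the side of the mean; the interpolation then costs an exponential factor \<open>(8 e) ^ k\<close>,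
which the growth of the binomial weights towards the mean compensates (\<open>tail_point_bound\<close>).
Averaging over many interlaced families of nodes avoids a loss proportional to the cardinality of \<open>B\<close>.

Finally \<open>V(a) \<le> a powr (1 / 8)\<close> for large \<open>a\<close>, so the loss \<open>exp (98 k / h)\<close> is within the allowed
\<open>exp (c2 k / V(N / k))\<close>.
\<close>

section \<open>Ratios of binomial weights\<close>

definition binom_weight :: "nat \<Rightarrow> real \<Rightarrow> nat \<Rightarrow> real" where
  "binom_weight n p j = real (n choose j) * p ^ j * (1 - p) ^ (n - j)"

lemma binom_weight_nonneg: "0 \<le> p \<Longrightarrow> p \<le> 1 \<Longrightarrow> 0 \<le> binom_weight n p j"
  by (simp add: binom_weight_def)

lemma binom_weight_Suc:
  assumes "j < n"
  shows "binom_weight n p (Suc j) * ((real j + 1) * (1 - p)) = binom_weight n p j * ((real n - real j) * p)"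
proof -
  have "Suc j * (n choose Suc j) = (n choose j) * (n - j)"
    using choose_mult_lemma binomial_absorb_comp[of n j] Suc_times_binomial_eq[of "n-1" j]
    by (metis binomial_absorption mult.commute)
  then have "real (Suc j * (n choose Suc j)) = real ((n choose j) * (n - j))" by simp
  then have 1: "real (n choose Suc j) * (real j + 1) = real (n choose j) * (real n - real j)"
    using assms by (simp add: of_nat_diff algebra_simps)
  have 2: "(1 - p) ^ (n - j) = (1 - p) * (1 - p) ^ (n - Suc j)"
    using assms by (metis Suc_diff_Suc power_Suc)
  have "binom_weight n p (Suc j) * ((real j + 1) * (1 - p))
      = (real (n choose Suc j) * (real j + 1)) * p ^ Suc j * ((1 - p) * (1 - p) ^ (n - Suc j))"
    by (simp add: binom_weight_def mult_ac)
  also have "\<dots> = binom_weight n p j * ((real n - real j) * p)"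
    unfolding 1 2[symmetric] by (simp add: binom_weight_def mult_ac)
  finally show ?thesis .
qed

text \<open>
Consecutive weights have ratio \<open>(n - j) p / ((j + 1) (1 - p))\<close>. Numerator and denominator both equal
the variance \<open>v\<close> up to an error proportional to the distance from the mean, so the logarithm of the
ratio is at most of order \<open>U / v\<close> within distance \<open>U\<close> of the mean.
\<close>

lemma binom_weight_step_bulk:
  assumes p: "0 < p" "p < 1" and j: "j < n" and v: "v = real n * p * (1 - p)"
    and U: "0 \<le> U" "U \<le> v / 2" "\<bar>real j - real n * p\<bar> \<le> U" "\<bar>real (Suc j) - real n * p\<bar> \<le> U"
    and v0: "v > 0"
  shows "binom_weight n p (Suc j) \<le> exp (2 * U / v) * binom_weight n p j"
    and "binom_weight n p j \<le> exp (2 * U / v) * binom_weight n p (Suc j)"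
proof -
  define a where "a = (real j + 1) * (1 - p)"
  define c where "c = (real n - real j) * p"
  define q where "q = 1 - p"
  have q: "0 < q" "q < 1" using p by (auto simp: q_def)
  have a_eq: "a = v + (real (Suc j) - real n * p) * q"
    by (simp add: a_def v q_def algebra_simps)
  have c_eq: "c = v - (real j - real n * p) * p"
    by (simp add: c_def v algebra_simps)
  have "\<bar>(real (Suc j) - real n * p) * q\<bar> \<le> U * q" "\<bar>(real j - real n * p) * p\<bar> \<le> U * p"
    using U p q by (auto simp: abs_mult intro!: mult_right_mono)
  then have bnd: "v - U * q \<le> a" "a \<le> v + U * q" "v - U * p \<le> c" "c \<le> v + U * p"
    unfolding a_eq c_eq by linarith+
  have key: "v + U * t \<le> exp (2 * U / v) * (v - U * t')" if "t + t' = 1" "0 \<le> t'" "t' \<le> 1" for t t'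
  proof -
    have d: "v / 2 \<le> v - U * t'"
      using mult_left_mono[OF that(3) U(1)] U by simp
    have t: "t = 1 - t'" using that(1) by simp
    have "U \<le> (2 * U / v) * (v - U * t')"
      using mult_left_mono[OF d, of "2 * U / v"] U v0 by simp
    moreover have "v + U * t = (v - U * t') + U" unfolding t by (simp add: algebra_simps)
    ultimately have "v + U * t \<le> (1 + 2 * U / v) * (v - U * t')"
      by (simp add: distrib_right)
    also have "\<dots> \<le> exp (2 * U / v) * (v - U * t')"
      using d v0 by (intro mult_right_mono exp_ge_add_one_self) auto
    finally show ?thesis .
  qed
  have E: "0 < exp (2 * U / v)" by simp
  have pq: "p + q = 1" "q + p = 1" "0 \<le> p" "p \<le> 1" "0 \<le> q" "q \<le> 1" using p q by (auto simp: q_def)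
  have ca: "c \<le> exp (2 * U / v) * a"
    by (rule order_trans[OF bnd(4) order_trans[OF key[OF pq(1,5,6)] mult_left_mono[OF bnd(1) less_imp_le[OF E]]]])
  have ac: "a \<le> exp (2 * U / v) * c"
    by (rule order_trans[OF bnd(2) order_trans[OF key[OF pq(2,3,4)] mult_left_mono[OF bnd(3) less_imp_le[OF E]]]])
  have w0: "0 \<le> binom_weight n p i" for i using p by (simp add: binom_weight_nonneg)
  have a0: "a > 0" using p by (simp add: a_def add_pos_nonneg)
  have c0: "c > 0" using p j by (simp add: c_def)
  have rec: "binom_weight n p (Suc j) * a = binom_weight n p j * c"
    using binom_weight_Suc[OF j] by (simp add: a_def c_def)
  have "binom_weight n p (Suc j) * a \<le> (exp (2 * U / v) * binom_weight n p j) * a"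
    unfolding rec using mult_left_mono[OF ca w0] by (simp add: mult_ac)
  then show "binom_weight n p (Suc j) \<le> exp (2 * U / v) * binom_weight n p j" using a0 by simp
  have "binom_weight n p j * c \<le> (exp (2 * U / v) * binom_weight n p (Suc j)) * c"
    unfolding rec[symmetric] using mult_left_mono[OF ac w0] by (simp add: mult_ac)
  then show "binom_weight n p j \<le> exp (2 * U / v) * binom_weight n p (Suc j)" using c0 by simp
qed

lemma binom_weight_bulk_ratio:
  assumes p: "0 < p" "p < 1" and v: "v = real n * p * (1 - p)" "v > 0"
    and U: "0 \<le> U" "U \<le> v / 2"
    and ij: "i \<le> n" "j \<le> n" "\<bar>real i - real n * p\<bar> \<le> U" "\<bar>real j - real n * p\<bar> \<le> U"
  shows "binom_weight n p i \<le> exp (2 * U / v * \<bar>real i - real j\<bar>) * binom_weight n p j"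
proof -
  have gen: "binom_weight n p i \<le> exp (2 * U / v * real d) * binom_weight n p (i + d) \<and>
        binom_weight n p (i + d) \<le> exp (2 * U / v * real d) * binom_weight n p i"
    if "i + d \<le> n" "\<bar>real i - real n * p\<bar> \<le> U" "\<bar>real (i + d) - real n * p\<bar> \<le> U" for i d
    using that
  proof (induction d)
    case (Suc d)
    have in': "\<bar>real (i + d) - real n * p\<bar> \<le> U" using Suc.prems by simp
    have IH: "binom_weight n p i \<le> exp (2 * U / v * real d) * binom_weight n p (i + d)"
      "binom_weight n p (i + d) \<le> exp (2 * U / v * real d) * binom_weight n p i"
      using Suc.IH Suc.prems in' by auto
    have st: "binom_weight n p (Suc (i + d)) \<le> exp (2 * U / v) * binom_weight n p (i + d)"
      "binom_weight n p (i + d) \<le> exp (2 * U / v) * binom_weight n p (Suc (i + d))"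
      using binom_weight_step_bulk[OF p _ v(1) U in' _ v(2)] Suc.prems by auto
    have ex: "exp (2 * U / v * real (Suc d)) = exp (2 * U / v * real d) * exp (2 * U / v)"
      by (simp add: exp_add[symmetric] add_divide_distrib algebra_simps)
    have "binom_weight n p i \<le> exp (2 * U / v * real (Suc d)) * binom_weight n p (Suc (i + d))"
      using order_trans[OF IH(1) mult_left_mono[OF st(2)]] unfolding ex by (simp add: mult_ac)
    moreover have "binom_weight n p (Suc (i + d)) \<le> exp (2 * U / v * real (Suc d)) * binom_weight n p i"
      using order_trans[OF st(1) mult_left_mono[OF IH(2)]] unfolding ex by (simp add: mult_ac)
    ultimately show ?case by simp
  qed simp
  show ?thesis
  proof (cases "i \<le> j")
    case True
    then show ?thesis using gen[of i "j - i"] ij by (simp add: of_nat_diff)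
  next
    case False
    then show ?thesis using gen[of j "i - j"] ij by (simp add: of_nat_diff)
  qed
qed

text \<open>
The same formula for the ratio shows that beyond distance \<open>U\<close> from the mean every step outwards loses
at least a factor \<open>exp (- U / (2 v))\<close>, however far out the step is taken: the ratio is monotone in \<open>j\<close>.
\<close>

lemma binom_weight_step_tail:
  assumes p: "0 < p" "p < 1" and j: "j < n" and v: "v = real n * p * (1 - p)" "v > 0"
    and U: "0 \<le> U" "U \<le> v"
  shows "real j - real n * p \<ge> U \<Longrightarrow> binom_weight n p (Suc j) \<le> exp (- U / (2 * v)) * binom_weight n p j"
    and "real (Suc j) - real n * p \<le> - U \<Longrightarrow> binom_weight n p j \<le> exp (- U / (2 * v)) * binom_weight n p (Suc j)"
proof -
  define a where "a = (real j + 1) * (1 - p)"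
  define c where "c = (real n - real j) * p"
  define q where "q = 1 - p"
  have q: "0 < q" "q < 1" using p by (auto simp: q_def)
  have a_eq: "a = v + (real (Suc j) - real n * p) * q"
    by (simp add: a_def v q_def algebra_simps)
  have c_eq: "c = v - (real j - real n * p) * p"
    by (simp add: c_def v algebra_simps)
  have w0: "0 \<le> binom_weight n p i" for i using p by (simp add: binom_weight_nonneg)
  have a0: "a > 0" using p by (simp add: a_def add_pos_nonneg)
  have c0: "c > 0" using p j by (simp add: c_def)
  have rec: "binom_weight n p (Suc j) * a = binom_weight n p j * c"
    using binom_weight_Suc[OF j] by (simp add: a_def c_def)
  \<comment> \<open>At distance \<open>u\<close> from the mean both step ratios have the form \<open>(v - u t) / (v + u (1 - t))\<close>,
    with \<open>t = p\<close> on the right and \<open>t = 1 - p\<close> on the left.\<close>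
  have key: "v - u * t \<le> exp (- U / (2 * v)) * (v + u * (1 - t))" if u: "u \<ge> U" and t: "0 \<le> t" "t \<le> 1" for u t
  proof -
    have x: "0 \<le> U / (2 * v)" "U / (2 * v) \<le> 1 / 2" using U v(2) by (auto simp: divide_simps)
    have "(1 - U / (2 * v)) * (v + u * (1 - t)) = v + u * (1 - t) - U / 2 - (U / (2 * v)) * (u * (1 - t))"
      using v(2) by (simp add: field_simps)
    moreover have "(U / (2 * v)) * (u * (1 - t)) \<le> 1 / 2 * (u * 1)"
      using x u U t by (intro mult_mono) auto
    ultimately have "v - u * t \<le> (1 - U / (2 * v)) * (v + u * (1 - t))"
    proof -
      assume 1: "(1 - U / (2 * v)) * (v + u * (1 - t)) = v + u * (1 - t) - U / 2 - (U / (2 * v)) * (u * (1 - t))"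
        and 2: "(U / (2 * v)) * (u * (1 - t)) \<le> 1 / 2 * (u * 1)"
      have "v - u * t = v + u * (1 - t) - u" by (simp add: algebra_simps)
      then show ?thesis using 1 2 u by linarith
    qed
    also have "\<dots> \<le> exp (- U / (2 * v)) * (v + u * (1 - t))"
      using exp_ge_add_one_self[of "- U / (2 * v)"] u U v(2) t
      by (intro mult_right_mono) (auto intro!: add_nonneg_nonneg)
    finally show ?thesis .
  qed
  show "binom_weight n p (Suc j) \<le> exp (- U / (2 * v)) * binom_weight n p j"
    if u: "real j - real n * p \<ge> U"
  proof -
    have "c \<le> exp (- U / (2 * v)) * (v + (real j - real n * p) * q)"
      using key[OF u, of p] p by (simp add: c_eq q_def)
    also have "\<dots> \<le> exp (- U / (2 * v)) * a"
      unfolding a_eq using q by (intro mult_left_mono add_left_mono mult_right_mono) auto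
    finally have "c \<le> exp (- U / (2 * v)) * a" .
    from mult_left_mono[OF this w0[of j]]
    have "binom_weight n p (Suc j) * a \<le> (exp (- U / (2 * v)) * binom_weight n p j) * a"
      unfolding rec by (simp add: mult_ac)
    then show ?thesis using a0 by simp
  qed
  show "binom_weight n p j \<le> exp (- U / (2 * v)) * binom_weight n p (Suc j)"
    if u: "real (Suc j) - real n * p \<le> - U"
  proof -
    define u' where "u' = real n * p - real (Suc j)"
    have u': "u' \<ge> U" using u by (simp add: u'_def)
    have "a = v - u' * q" by (simp add: a_eq u'_def algebra_simps)
    also have "\<dots> \<le> exp (- U / (2 * v)) * (v + u' * p)"
      using key[OF u', of q] q by (simp add: q_def)
    also have "\<dots> \<le> exp (- U / (2 * v)) * c"
      unfolding c_eq u'_def using p by (intro mult_left_mono) (auto simp: algebra_simps)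
    finally have "a \<le> exp (- U / (2 * v)) * c" .
    from mult_left_mono[OF this w0[of "Suc j"]]
    have "binom_weight n p j * c \<le> (exp (- U / (2 * v)) * binom_weight n p (Suc j)) * c"
      unfolding rec[symmetric] by (simp add: mult_ac)
    then show ?thesis using c0 by simp
  qed
qed

lemma binom_weight_tail_ratio:
  assumes p: "0 < p" "p < 1" and v: "v = real n * p * (1 - p)" "v > 0"
    and U: "0 \<le> U" "U \<le> v" and n: "i + d \<le> n"
  shows "real i - real n * p \<ge> U \<Longrightarrow>
      binom_weight n p (i + d) \<le> exp (- U / (2 * v) * real d) * binom_weight n p i"
    and "real (i + d) - real n * p \<le> - U \<Longrightarrow>
      binom_weight n p i \<le> exp (- U / (2 * v) * real d) * binom_weight n p (i + d)"
proof -
  have ex: "exp (- U / (2 * v) * real (Suc d)) = exp (- U / (2 * v) * real d) * exp (- U / (2 * v))" for d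
    by (simp add: exp_add[symmetric] add_divide_distrib algebra_simps)
  show "binom_weight n p (i + d) \<le> exp (- U / (2 * v) * real d) * binom_weight n p i"
    if "real i - real n * p \<ge> U"
    using n
  proof (induction d)
    case (Suc d)
    have IH: "binom_weight n p (i + d) \<le> exp (- U / (2 * v) * real d) * binom_weight n p i"
      using Suc by simp
    have st: "binom_weight n p (Suc (i + d)) \<le> exp (- U / (2 * v)) * binom_weight n p (i + d)"
      using binom_weight_step_tail(1)[OF p _ v U, of "i + d"] Suc.prems that by auto
    show ?case using order_trans[OF st mult_left_mono[OF IH]] unfolding ex by (simp add: mult_ac)
  qed simp
  show "binom_weight n p i \<le> exp (- U / (2 * v) * real d) * binom_weight n p (i + d)"
    if "real (i + d) - real n * p \<le> - U"
    using n that
  proof (induction d)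
    case (Suc d)
    have IH: "binom_weight n p i \<le> exp (- U / (2 * v) * real d) * binom_weight n p (i + d)"
      using Suc by simp
    have st: "binom_weight n p (i + d) \<le> exp (- U / (2 * v)) * binom_weight n p (Suc (i + d))"
      using binom_weight_step_tail(2)[OF p _ v U, of "i + d"] Suc.prems by auto
    show ?case using order_trans[OF IH mult_left_mono[OF st]] unfolding ex by (simp add: mult_ac)
  qed simp
qed

section \<open>Duality for laws of bits\<close>

text \<open>
First-order optimality condition: the quadratic term is negligible for small \<open>t\<close>.
\<close>

lemma nonneg_if_quadratic_nonneg:
  fixes x S :: real
  assumes "S \<ge> 0" "\<And>t. 0 < t \<Longrightarrow> t < 1 \<Longrightarrow> 0 \<le> 2 * t * x + t\<^sup>2 * S"
  shows "0 \<le> x"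
proof (rule ccontr)
  assume "\<not> 0 \<le> x"
  then have x: "x < 0" by simp
  \<comment> \<open>Small enough for \<open>t S \<le> - x\<close>, and below 1.\<close>
  define t where "t = - x / (S + 1 - x)"
  have t: "0 < t" "t < 1" using x assms(1) by (auto simp: t_def field_simps)
  have "t * S \<le> - x"
  proof -
    have "S / (S + 1 - x) \<le> 1" using x assms(1) by simp
    from mult_left_mono[OF this, of "- x"] show ?thesis using x by (simp add: t_def)
  qed
  then have "t * (2 * x + t * S) < 0" using t x by (intro mult_pos_neg) auto
  with assms(2)[OF t] show False by (simp add: power2_eq_square algebra_simps)
qed

text \<open>
A Farkas lemma. The residual \<open>A \<mu> - b\<close> of a least-squares solution over the cone of nonnegative \<open>\<mu>\<close> is
itself a dual certificate: the optimality conditions say that it is nonnegative against every generator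
\<open>a j\<close> and orthogonal to \<open>A \<mu>\<close>, so its pairing with \<open>b\<close> is minus its squared norm, and the dual assumption
forces it to vanish. The coordinate \<open>i0\<close> bounds the total mass of the competitors, which gives the
compactness that makes the minimum exist.
\<close>

lemma finite_farkas:
  fixes a :: "'a \<Rightarrow> 'b \<Rightarrow> real" and b :: "'b \<Rightarrow> real"
  assumes fin: "finite J" "finite I" and i0: "i0 \<in> I" "\<And>j. j \<in> J \<Longrightarrow> a j i0 = 1"
    and dual: "\<And>c. (\<And>j. j \<in> J \<Longrightarrow> 0 \<le> (\<Sum>i\<in>I. c i * a j i)) \<Longrightarrow> 0 \<le> (\<Sum>i\<in>I. c i * b i)"
  obtains \<mu> where "\<And>j. 0 \<le> \<mu> j" "\<And>i. i \<in> I \<Longrightarrow> (\<Sum>j\<in>J. \<mu> j * a j i) = b i"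
proof -
  define A where "A \<mu> i = (\<Sum>j\<in>J. \<mu> j * a j i)" for \<mu> i
  define F where "F \<mu> = (\<Sum>i\<in>I. (A \<mu> i - b i)\<^sup>2)" for \<mu>
  \<comment> \<open>A competitor with a coordinate above \<open>B\<close> is worse than 0 already in the coordinate \<open>i0\<close>.\<close>
  define B where "B = \<bar>b i0\<bar> + (\<Sum>i\<in>I. (b i)\<^sup>2) + 1"
  have B0: "B \<ge> 0" by (auto simp: B_def intro!: add_nonneg_nonneg sum_nonneg)
  define K where "K = PiE UNIV (\<lambda>j. if j \<in> J then {0..B} else {0::real})"
  have "compact K"
    using compactin_PiE[of "\<lambda>_. euclidean :: real topology" UNIV "\<lambda>j. if j \<in> J then {0..B} else {0}"]
    by (simp add: K_def euclidean_product_topology)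
  have zK: "(\<lambda>_. 0) \<in> K" using B0 by (auto simp: K_def)
  have "continuous_on K F"
    unfolding F_def A_def
    by (intro continuous_intros continuous_on_subset[OF continuous_on_product_coordinates]) auto
  then obtain \<mu> where \<mu>: "\<mu> \<in> K" "\<And>\<nu>. \<nu> \<in> K \<Longrightarrow> F \<mu> \<le> F \<nu>"
    using continuous_attains_inf[OF \<open>compact K\<close>, of F] zK by blast
  have \<mu>0: "0 \<le> \<mu> j" for j using \<mu>(1) B0 by (auto simp: K_def PiE_iff split: if_splits)
  have \<mu>z: "\<mu> j = 0" if "j \<notin> J" for j using \<mu>(1) that by (auto simp: K_def PiE_iff dest: spec[of _ j])
  have min: "F \<mu> \<le> F \<nu>" if \<nu>: "\<And>j. 0 \<le> \<nu> j" "\<And>j. j \<notin> J \<Longrightarrow> \<nu> j = 0" for \<nu>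
  proof (cases "\<nu> \<in> K")
    case False
    then obtain j where j: "j \<in> J" "\<nu> j > B"
      using \<nu> by (auto simp: K_def PiE_iff not_le split: if_splits)
    have "\<nu> j \<le> (\<Sum>j\<in>J. \<nu> j)" using fin j \<nu> by (intro member_le_sum) auto
    also have "\<dots> = A \<nu> i0" using i0 by (simp add: A_def)
    finally have "A \<nu> i0 - b i0 > (\<Sum>i\<in>I. (b i)\<^sup>2) + 1" using j by (auto simp: B_def)
    moreover have S0: "0 \<le> (\<Sum>i\<in>I. (b i)\<^sup>2)" by (simp add: sum_nonneg)
    ultimately have "((\<Sum>i\<in>I. (b i)\<^sup>2) + 1)\<^sup>2 \<le> (A \<nu> i0 - b i0)\<^sup>2" by (intro power_mono) auto
    moreover have "(\<Sum>i\<in>I. (b i)\<^sup>2) \<le> ((\<Sum>i\<in>I. (b i)\<^sup>2) + 1)\<^sup>2"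
      using S0 by (simp add: power2_eq_square algebra_simps)
    moreover have "(A \<nu> i0 - b i0)\<^sup>2 \<le> F \<nu>"
      unfolding F_def by (rule member_le_sum[OF i0(1)]) (auto simp: fin)
    moreover have "F \<mu> \<le> F (\<lambda>_. 0)" using \<mu>(2) zK by blast
    moreover have "F (\<lambda>_. 0) = (\<Sum>i\<in>I. (b i)\<^sup>2)" by (simp add: F_def A_def)
    ultimately show ?thesis by linarith
  qed (rule \<mu>(2))
  define \<rho> where "\<rho> i = A \<mu> i - b i" for i
  have expand: "(\<Sum>i\<in>I. (\<rho> i + t * d i)\<^sup>2) = F \<mu> + 2 * t * (\<Sum>i\<in>I. \<rho> i * d i) + t\<^sup>2 * (\<Sum>i\<in>I. (d i)\<^sup>2)"
    for t d
    unfolding F_def \<rho>_def sum_distrib_left sum.distrib[symmetric]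
    by (intro sum.cong) (auto simp: power2_eq_square algebra_simps)
  have grad: "0 \<le> (\<Sum>i\<in>I. \<rho> i * a j i)" if j: "j \<in> J" for j
  proof (rule nonneg_if_quadratic_nonneg)
    fix t :: real assume t: "0 < t" "t < 1"
    have "A (\<mu>(j := \<mu> j + t)) i = A \<mu> i + t * a j i" for i
    proof -
      have "A (\<mu>(j := \<mu> j + t)) i = (\<Sum>l\<in>J. \<mu> l * a l i + (if l = j then t * a j i else 0))"
        unfolding A_def by (intro sum.cong) (auto simp: algebra_simps)
      then show ?thesis using j fin by (simp add: A_def sum.distrib)
    qed
    then have "F (\<mu>(j := \<mu> j + t)) = (\<Sum>i\<in>I. (\<rho> i + t * a j i)\<^sup>2)"
      by (simp add: F_def \<rho>_def algebra_simps)
    moreover have "F \<mu> \<le> F (\<mu>(j := \<mu> j + t))"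
      using \<mu>0 \<mu>z j t by (intro min) (auto intro: add_nonneg_nonneg)
    ultimately show "0 \<le> 2 * t * (\<Sum>i\<in>I. \<rho> i * a j i) + t\<^sup>2 * (\<Sum>i\<in>I. (a j i)\<^sup>2)"
      unfolding expand by linarith
  qed (simp add: sum_nonneg)
  \<comment> \<open>Shrinking \<open>\<mu>\<close> to \<open>(1 - t) \<mu>\<close> cannot decrease the residual either.\<close>
  have scale: "0 \<le> - (\<Sum>i\<in>I. \<rho> i * A \<mu> i)"
  proof (rule nonneg_if_quadratic_nonneg)
    fix t :: real assume t: "0 < t" "t < 1"
    have Aeq: "A (\<lambda>j. (1 - t) * \<mu> j) i = A \<mu> i + t * (- A \<mu> i)" for i
      by (simp add: A_def sum_distrib_left algebra_simps sum_subtractf)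
    have "F (\<lambda>j. (1 - t) * \<mu> j) = (\<Sum>i\<in>I. (\<rho> i + t * (- A \<mu> i))\<^sup>2)"
      unfolding F_def \<rho>_def Aeq by (intro sum.cong) (auto simp: algebra_simps)
    moreover have "F \<mu> \<le> F (\<lambda>j. (1 - t) * \<mu> j)" using \<mu>0 \<mu>z t by (intro min) auto
    ultimately have "0 \<le> 2 * t * (\<Sum>i\<in>I. \<rho> i * - A \<mu> i) + t\<^sup>2 * (\<Sum>i\<in>I. (- A \<mu> i)\<^sup>2)"
      unfolding expand by linarith
    then show "0 \<le> 2 * t * (- (\<Sum>i\<in>I. \<rho> i * A \<mu> i)) + t\<^sup>2 * (\<Sum>i\<in>I. (A \<mu> i)\<^sup>2)"
      by (simp add: sum_negf)
  qed (simp add: sum_nonneg)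
  have "0 \<le> (\<Sum>i\<in>I. \<rho> i * b i)" by (rule dual) (rule grad)
  also have "\<dots> = (\<Sum>i\<in>I. \<rho> i * A \<mu> i) - (\<Sum>i\<in>I. (\<rho> i)\<^sup>2)"
    by (simp add: \<rho>_def power2_eq_square algebra_simps sum_subtractf[symmetric])
  finally have "(\<Sum>i\<in>I. (\<rho> i)\<^sup>2) \<le> 0" using scale by linarith
  then have "\<rho> i = 0" if "i \<in> I" for i
    using that fin sum_nonneg_eq_0_iff[of I "\<lambda>i. (\<rho> i)\<^sup>2"] sum_nonneg[of I "\<lambda>i. (\<rho> i)\<^sup>2"]
    by (auto intro: antisym)
  then show ?thesis using \<mu>0 by (intro that[of \<mu>]) (auto simp: \<rho>_def A_def)
qed

lemma sum_poly_eq_moments: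
  fixes R :: "real poly"
  assumes "degree R \<le> k"
  shows "(\<Sum>j\<le>n. f j * poly R (real j)) = (\<Sum>i\<le>k. coeff R i * (\<Sum>j\<le>n. f j * real j ^ i))"
proof -
  have "poly R x = (\<Sum>i\<le>k. coeff R i * x ^ i)" for x
    using assms by (simp add: poly_altdef) (intro sum.mono_neutral_left, auto simp: coeff_eq_0)
  then have "(\<Sum>j\<le>n. f j * poly R (real j)) = (\<Sum>j\<le>n. \<Sum>i\<le>k. coeff R i * (f j * real j ^ i))"
    by (simp add: sum_distrib_left mult_ac)
  also have "\<dots> = (\<Sum>i\<le>k. \<Sum>j\<le>n. coeff R i * (f j * real j ^ i))" by (rule sum.swap)
  finally show ?thesis by (simp add: sum_distrib_left)
qed

lemma binom_weight_factorial_moment: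
  assumes "l \<le> n"
  shows "(\<Sum>j\<le>n. binom_weight n p j * real (j choose l)) = real (n choose l) * p ^ l"
proof -
  have "(\<Sum>j\<le>n. binom_weight n p j * real (j choose l))
      = (\<Sum>j\<in>{l..n}. binom_weight n p j * real (j choose l))"
    by (rule sum.mono_neutral_right) auto
  also have "\<dots> = (\<Sum>i\<le>n - l. real (n choose l) * p ^ l * (real ((n - l) choose i) * p ^ i * (1 - p) ^ (n - l - i)))"
  proof (rule sum.reindex_bij_witness[of _ "\<lambda>i. i + l" "\<lambda>j. j - l"])
    fix j assume j: "j \<in> {l..n}"
    have "real ((n choose j) * (j choose l)) = real ((n choose l) * ((n - l) choose (j - l)))"
      using j by (subst choose_mult) auto
    moreover have "p ^ j = p ^ l * p ^ (j - l)" using j by (simp add: power_add[symmetric])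
    moreover have "n - l - (j - l) = n - j" using j by simp
    ultimately show "real (n choose l) * p ^ l * (real ((n - l) choose (j - l)) * p ^ (j - l) * (1 - p) ^ (n - l - (j - l)))
        = binom_weight n p j * real (j choose l)"
      by (simp add: binom_weight_def mult_ac)
  qed (use assms in auto)
  also have "\<dots> = real (n choose l) * p ^ l * (p + (1 - p)) ^ (n - l)"
    unfolding binomial_ring by (simp add: sum_distrib_left)
  finally show ?thesis by simp
qed

definition binomial_coefficient_poly :: "nat \<Rightarrow> real poly" where
  "binomial_coefficient_poly l = smult (1 / fact l) (\<Prod>i<l. [:- real i, 1:])"

lemma poly_binomial_coefficient_poly: "poly (binomial_coefficient_poly l) (real j) = real (j choose l)"
  by (simp add: binomial_coefficient_poly_def poly_prod binomial_gbinomial gbinomial_prod_rev atLeast0LessThan)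

lemma degree_binomial_coefficient_poly: "degree (binomial_coefficient_poly l) \<le> l"
proof -
  have "degree (\<Prod>i<l. [:- real i, 1:]) \<le> l"
    by (rule order_trans[OF degree_prod_sum_le]) (auto simp: o_def)
  then show ?thesis
    unfolding binomial_coefficient_poly_def by (rule order_trans[OF degree_smult_le])
qed

lemma card_supersets_of_card:
  assumes "finite X" "S \<subseteq> X" "card S \<le> j"
  shows "card {A. S \<subseteq> A \<and> A \<subseteq> X \<and> card A = j} = (card X - card S) choose (j - card S)"
proof -
  have fS: "finite S" using assms finite_subset by blast
  have "bij_betw (\<lambda>B. S \<union> B) {B. B \<subseteq> X - S \<and> card B = j - card S} {A. S \<subseteq> A \<and> A \<subseteq> X \<and> card A = j}"
  proof (rule bij_betw_byWitness[of _ "\<lambda>A. A - S"])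
    show "(\<union>) S ` {B. B \<subseteq> X - S \<and> card B = j - card S} \<subseteq> {A. S \<subseteq> A \<and> A \<subseteq> X \<and> card A = j}"
    proof (rule image_subsetI)
      fix B assume "B \<in> {B. B \<subseteq> X - S \<and> card B = j - card S}"
      then have B: "B \<subseteq> X - S" "card B = j - card S" by auto
      have "finite B" using B assms(1) finite_subset by blast
      then have "card (S \<union> B) = card S + card B" using B fS by (intro card_Un_disjoint) auto
      then show "S \<union> B \<in> {A. S \<subseteq> A \<and> A \<subseteq> X \<and> card A = j}" using B assms by auto
    qed
    show "(\<lambda>A. A - S) ` {A. S \<subseteq> A \<and> A \<subseteq> X \<and> card A = j} \<subseteq> {B. B \<subseteq> X - S \<and> card B = j - card S}"
      using fS by (auto simp: card_Diff_subset)
  qed auto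
  from bij_betw_same_card[OF this]
  have "card {A. S \<subseteq> A \<and> A \<subseteq> X \<and> card A = j} = card {B. B \<subseteq> X - S \<and> card B = j - card S}"
    by (rule sym)
  also have "\<dots> = card (X - S) choose (j - card S)" using assms by (intro n_subsets) auto
  finally show ?thesis using fS assms by (simp add: card_Diff_subset)
qed

text \<open>
Weights on \<open>0, \<dots>, n\<close> become a law of bits by choosing the number of ones according to the weights and then
the set of ones uniformly among the sets of that size. The probability that the bits in a set of size \<open>l\<close>
are all one is then a multiple of the expected binomial coefficient \<open>j choose l\<close>, a polynomial of degree
\<open>l\<close> in the number \<open>j\<close> of ones. Hence matching the first \<open>k\<close> binomial moments is the same as \<open>k\<close>-wise independence.
\<close>

lemma M_ge_exchangeable_weight:
  assumes p: "0 < p" "p < 1" and \<mu>0: "\<And>j. 0 \<le> \<mu> j"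
    and mom: "\<And>i. i \<le> k \<Longrightarrow> (\<Sum>j\<le>n. \<mu> j * real j ^ i) = (\<Sum>j\<le>n. binom_weight n p j * real j ^ i)"
  shows "\<mu> n \<le> M n k p"
proof -
  define g where "g A = (if A \<subseteq> {1..n} then \<mu> (card A) / real (n choose card A) else 0)" for A :: "nat set"
  have g0: "0 \<le> g A" for A using \<mu>0 by (simp add: g_def)
  have fact_mom: "(\<Sum>j\<le>n. \<mu> j * real (j choose l)) = real (n choose l) * p ^ l" if "l \<le> k" "l \<le> n" for l
  proof -
    have "(\<Sum>j\<le>n. \<mu> j * real (j choose l)) = (\<Sum>j\<le>n. binom_weight n p j * real (j choose l))"
      unfolding poly_binomial_coefficient_poly[symmetric]
        sum_poly_eq_moments[OF order_trans[OF degree_binomial_coefficient_poly that(1)]]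
      by (intro sum.cong) (auto simp: mom)
    then show ?thesis using binom_weight_factorial_moment[OF that(2)] by simp
  qed
  have sumg: "(\<Sum>A | S \<subseteq> A \<and> A \<subseteq> {1..n}. g A) = p ^ card S" if S: "S \<subseteq> {1..n}" "card S \<le> k" for S
  proof -
    let ?T = "{A. S \<subseteq> A \<and> A \<subseteq> {1..n}}"
    have finT: "finite ?T" by (rule finite_subset[of _ "Pow {1..n}"]) auto
    have ln: "card S \<le> n" using card_mono[OF _ S(1)] by simp
    have "(\<Sum>A\<in>?T. g A) = (\<Sum>j\<le>n. \<Sum>A\<in>{A \<in> ?T. card A = j}. g A)"
    proof (rule sum.group[symmetric])
      show "card ` ?T \<subseteq> {..n}" using card_mono[of "{1..n}"] by auto
    qed (use finT in auto)
    also have "\<dots> = (\<Sum>j\<le>n. \<mu> j * real (j choose card S) / real (n choose card S))"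
    proof (rule sum.cong[OF refl])
      fix j assume "j \<in> {..n}"
      then have j: "j \<le> n" by simp
      have "(\<Sum>A\<in>{A \<in> ?T. card A = j}. g A) = real (card {A \<in> ?T. card A = j}) * (\<mu> j / real (n choose j))"
        by (simp add: g_def)
      also have "real (card {A \<in> ?T. card A = j}) = real (n choose j) * (real (j choose card S) / real (n choose card S))"
      proof (cases "card S \<le> j")
        case True
        have "card {A \<in> ?T. card A = j} = (n - card S) choose (j - card S)"
          using card_supersets_of_card[OF _ S(1) True] by (simp add: conj_assoc)
        moreover have "real ((n choose j) * (j choose card S)) = real ((n choose card S) * ((n - card S) choose (j - card S)))"
          using choose_mult[OF True j] by simp
        ultimately show ?thesis using ln by (simp add: field_simps)
      next
        case False
        have "{A \<in> ?T. card A = j} = {}"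
        proof (intro equals0I)
          fix A assume "A \<in> {A \<in> ?T. card A = j}"
          then have A: "S \<subseteq> A" "A \<subseteq> {1..n}" "card A = j" by auto
          then have "finite A" using finite_subset[of A "{1..n}"] by simp
          then show False using card_mono[of A S] A False by simp
        qed
        then have "card {A \<in> ?T. card A = j} = 0" by (simp only: card.empty)
        then show ?thesis using False by (simp add: binomial_eq_0)
      qed
      finally show "(\<Sum>A\<in>{A \<in> ?T. card A = j}. g A) = \<mu> j * real (j choose card S) / real (n choose card S)"
        using j by simp
    qed
    also have "\<dots> = p ^ card S"
      using fact_mom[OF S(2) ln] ln by (simp add: sum_divide_distrib[symmetric])
    finally show ?thesis .
  qed
  have "(\<integral>\<^sup>+A. ennreal (g A) \<partial>count_space UNIV) = (\<Sum>A\<in>Pow {1..n}. ennreal (g A))"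
    by (intro nn_integral_count_space') (auto simp: g_def)
  also have "\<dots> = ennreal (\<Sum>A\<in>Pow {1..n}. g A)" using g0 by (simp add: sum_ennreal)
  also have "(\<Sum>A\<in>Pow {1..n}. g A) = 1" using sumg[of "{}"] by (simp add: Pow_def)
  finally have pg: "pmf (embed_pmf g) A = g A" for A using g0 by (intro pmf_embed_pmf) auto
  have setg: "set_pmf (embed_pmf g) \<subseteq> Pow {1..n}"
    by (rule subsetI) (simp add: set_pmf_iff pg g_def split: if_splits)
  define bits where "bits A = (\<lambda>i\<in>{1..n}. if i \<in> A then 1 else 0 :: nat)" for A
  define Q where "Q = map_pmf bits (embed_pmf g)"
  have probQ: "measure_pmf.prob Q {x. \<forall>i\<in>S. x i = 1} = (\<Sum>A | S \<subseteq> A \<and> A \<subseteq> {1..n}. g A)"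
    if S: "S \<subseteq> {1..n}" for S
  proof -
    have "measure_pmf.prob Q {x. \<forall>i\<in>S. x i = 1} = measure_pmf.prob (embed_pmf g) {A. S \<subseteq> A}"
      unfolding Q_def measure_map_pmf
    proof (intro arg_cong[where f = "measure_pmf.prob (embed_pmf g)"])
      have "bits A i = 1 \<longleftrightarrow> i \<in> A" if "i \<in> S" for A i using that S by (auto simp: bits_def)
      then show "bits -` {x. \<forall>i\<in>S. x i = 1} = {A. S \<subseteq> A}" by auto
    qed
    also have "\<dots> = (\<Sum>A\<in>Pow {1..n} \<inter> {A. S \<subseteq> A}. pmf (embed_pmf g) A)"
      by (rule prob_eq_sum[OF _ setg]) simp
    also have "Pow {1..n} \<inter> {A. S \<subseteq> A} = {A. S \<subseteq> A \<and> A \<subseteq> {1..n}}" by auto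
    finally show ?thesis by (simp add: pg)
  qed
  have "set_pmf Q \<subseteq> {1..n} \<rightarrow>\<^sub>E {0, 1}" by (auto simp: Q_def bits_def split: if_splits)
  then have QA: "Q \<in> kwise_indep_laws n k p"
    using probQ sumg by (simp add: kwise_indep_laws_def)
  have "{A. {1..n} \<subseteq> A \<and> A \<subseteq> {1..n}} = {{1..n}}" by auto
  then have "measure_pmf.prob Q {x. \<forall>i\<in>{1..n}. x i = 1} = \<mu> n"
    using probQ[of "{1..n}"] by (simp add: g_def)
  moreover have "measure_pmf.prob Q {x. \<forall>i\<in>{1..n}. x i = 1} \<le> M n k p"
    unfolding M_def by (rule cSUP_upper[OF QA]) (auto intro!: bdd_aboveI[of _ 1])
  ultimately show ?thesis by simp
qed

text \<open>
Strong duality. Moving the mass \<open>c\<close> at \<open>n\<close> to the right-hand side, the remaining weights exist by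
\<open>finite_farkas\<close>, whose dual variables are the coefficients of a polynomial nonnegative on the integers.
\<close>

lemma M_ge_if_dual_bound:
  assumes p: "0 < p" "p < 1" and c: "c \<ge> 0"
    and bound: "\<And>P. degree P \<le> k \<Longrightarrow> (\<And>j. j \<le> n \<Longrightarrow> 0 \<le> poly P (real j)) \<Longrightarrow>
       c * poly P (real n) \<le> (\<Sum>j\<le>n. binom_weight n p j * poly P (real j))"
  shows "c \<le> M n k p"
proof -
  define b where "b i = (\<Sum>j\<le>n. binom_weight n p j * real j ^ i) - c * real n ^ i" for i
  obtain \<mu> where \<mu>: "\<And>j. 0 \<le> \<mu> j" "\<And>i. i \<in> {..k} \<Longrightarrow> (\<Sum>j\<in>{..n}. \<mu> j * real j ^ i) = b i"
  proof (rule finite_farkas[of "{..n}" "{..k}" 0 "\<lambda>j i. real j ^ i" b])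
    fix e :: "nat \<Rightarrow> real" assume e: "\<And>j. j \<in> {..n} \<Longrightarrow> 0 \<le> (\<Sum>i\<le>k. e i * real j ^ i)"
    define P where "P = (\<Sum>i\<le>k. monom (e i) i)"
    have polyP: "poly P x = (\<Sum>i\<le>k. e i * x ^ i)" for x by (simp add: P_def poly_sum poly_monom)
    have degP: "degree P \<le> k"
      unfolding P_def by (intro degree_sum_le) (auto intro: order_trans[OF degree_monom_le])
    have coeffP: "coeff P i = e i" if "i \<le> k" for i
      using that by (simp add: P_def coeff_sum)
    have "(\<Sum>i\<le>k. e i * b i) = (\<Sum>i\<le>k. coeff P i * (\<Sum>j\<le>n. binom_weight n p j * real j ^ i)) - c * (\<Sum>i\<le>k. e i * real n ^ i)"
      by (simp add: b_def right_diff_distrib sum_subtractf coeffP sum_distrib_left mult_ac)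
    also have "\<dots> = (\<Sum>j\<le>n. binom_weight n p j * poly P (real j)) - c * poly P (real n)"
      unfolding sum_poly_eq_moments[OF degP] by (simp only: polyP)
    also have "\<dots> \<ge> 0" using bound[OF degP] e by (simp add: polyP)
    finally show "0 \<le> (\<Sum>i\<le>k. e i * b i)" .
  qed auto
  define \<nu> where "\<nu> j = \<mu> j + (if j = n then c else 0)" for j
  have "\<nu> n \<le> M n k p"
  proof (rule M_ge_exchangeable_weight[OF p])
    fix i assume i: "i \<le> k"
    have "(\<Sum>j\<le>n. \<nu> j * real j ^ i) = (\<Sum>j\<le>n. \<mu> j * real j ^ i + (if j = n then c * real n ^ i else 0))"
      by (intro sum.cong) (auto simp: \<nu>_def algebra_simps)
    also have "\<dots> = b i + c * real n ^ i" using \<mu>(2) i by (simp add: sum.distrib)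
    finally show "(\<Sum>j\<le>n. \<nu> j * real j ^ i) = (\<Sum>j\<le>n. binom_weight n p j * real j ^ i)"
      by (simp add: b_def)
  qed (use \<mu> c in \<open>auto simp: \<nu>_def\<close>)
  then show ?thesis using \<mu>(1)[of n] by (simp add: \<nu>_def)
qed

section \<open>Duality for the relaxed problem\<close>

lemma expectation_binomial_pmf_eq_sum:
  assumes "0 < p" "p < 1"
  shows "measure_pmf.expectation (binomial_pmf n p) f = (\<Sum>j\<le>n. binom_weight n p j * f j)"
proof -
  have "measure_pmf.expectation (binomial_pmf n p) f = (\<Sum>j\<le>n. f j * pmf (binomial_pmf n p) j)"
    using assms by (intro integral_measure_pmf_real) (auto simp: set_pmf_binomial_eq split: if_splits)
  then show ?thesis using assms by (simp add: binom_weight_def mult_ac)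
qed

text \<open>
Weak duality: a polynomial nonnegative on \<open>[0, n]\<close> dominates \<open>Q(n)\<close> times the indicator of \<open>n\<close> there, and its
integral is determined by the first \<open>k\<close> moments.
\<close>

lemma M_tilde_mult_le_expectation:
  fixes Q :: "real poly"
  assumes p: "0 < p" "p < 1" and deg: "degree Q \<le> k"
    and nonneg: "\<And>x. 0 \<le> x \<Longrightarrow> x \<le> real n \<Longrightarrow> 0 \<le> poly Q x"
  shows "M_tilde n k p * poly Q (real n) \<le> (\<Sum>j\<le>n. binom_weight n p j * poly Q (real j))"
proof -
  have each: "measure \<mu> {real n} * poly Q (real n) \<le> (\<Sum>j\<le>n. binom_weight n p j * poly Q (real j))"
    if \<mu>: "\<mu> \<in> moment_matching_laws n k p" for \<mu>
  proof -
    interpret real_distribution \<mu> using \<mu> by (simp add: moment_matching_laws_def)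
    have supp: "AE s in \<mu>. s \<in> {0..real n}" using \<mu> by (simp add: moment_matching_laws_def)
    have int: "integrable \<mu> (\<lambda>s. s ^ i)" for i
    proof (rule integrable_const_bound[where B = "real n ^ i"])
      show "AE s in \<mu>. norm (s ^ i) \<le> real n ^ i"
        using supp by eventually_elim (auto simp: power_mono norm_power)
    qed simp
    have mom: "(LINT s|\<mu>. s ^ i) = (\<Sum>j\<le>n. binom_weight n p j * real j ^ i)" if "i \<le> k" for i
    proof (cases "i = 0")
      case True
      have "(LINT s|\<mu>. s ^ i) = 1" using True prob_space by simp
      moreover have "measure_pmf.expectation (binomial_pmf n p) (\<lambda>j. real j ^ i) = 1" using True by simp
      ultimately show ?thesis by (metis expectation_binomial_pmf_eq_sum[OF p])
    next
      case False
      then have "(LINT s|\<mu>. s ^ i) = measure_pmf.expectation (binomial_pmf n p) (\<lambda>j. real j ^ i)"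
        using \<mu> that by (auto simp: moment_matching_laws_def)
      then show ?thesis by (simp add: expectation_binomial_pmf_eq_sum[OF p])
    qed
    have polyQ: "poly Q x = (\<Sum>i\<le>k. coeff Q i * x ^ i)" for x
      using deg by (simp add: poly_altdef) (intro sum.mono_neutral_left, auto simp: coeff_eq_0)
    have intQ: "integrable \<mu> (poly Q)"
      unfolding polyQ[abs_def] by (intro Bochner_Integration.integrable_sum integrable_mult_right int)
    have "measure \<mu> {real n} * poly Q (real n) = (LINT s|\<mu>. indicator {real n} s * poly Q (real n))"
      by simp
    also have "\<dots> \<le> (LINT s|\<mu>. poly Q s)"
    proof (rule integral_mono_AE)
      show "AE s in \<mu>. indicator {real n} s * poly Q (real n) \<le> poly Q s"
        using supp by eventually_elim (auto simp: indicator_def nonneg)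
    qed (auto intro: intQ integrable_const_bound[where B = "1"])
    also have "\<dots> = (\<Sum>i\<le>k. coeff Q i * (LINT s|\<mu>. s ^ i))"
      unfolding polyQ by (subst Bochner_Integration.integral_sum) (auto intro: int)
    also have "\<dots> = (\<Sum>j\<le>n. binom_weight n p j * poly Q (real j))"
      unfolding sum_poly_eq_moments[OF deg] by (intro sum.cong) (auto simp: mom)
    finally show ?thesis .
  qed
  show ?thesis using M_tilde_attained[OF p, of n k] each by metis
qed

section \<open>Polynomials that are nonnegative on the integers\<close>

text \<open>
Splits off the two ends \<open>r\<close> and \<open>s\<close> of the largest interval around \<open>t\<close> on which \<open>P\<close> is negative. On the closed
interval the sign of the cofactor needs continuity, since \<open>r\<close> or \<open>s\<close> may be an integer.
\<close>

lemma factor_two_roots: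
  fixes P :: "real poly"
  assumes neg: "poly P t < 0" and jt: "real j < t" "t < real j + 1"
    and end0: "poly P (real j) \<ge> 0" "poly P (real j + 1) \<ge> 0"
  obtains r s P' where "P = [:- r, 1:] * [:- s, 1:] * P'" "real j \<le> r" "r < s" "s \<le> real j + 1"
    and "\<And>x. r \<le> x \<Longrightarrow> x \<le> s \<Longrightarrow> 0 \<le> poly P' x"
proof -
  have P0: "P \<noteq> 0" using neg by auto
  define Z where "Z = {x. poly P x = 0}"
  have finZ: "finite Z" unfolding Z_def by (rule poly_roots_finite[OF P0])
  have cont: "continuous_on A (poly P)" for A by (intro continuous_intros)
  have "\<exists>x\<ge>real j. x \<le> t \<and> poly P x = 0"
    using IVT2'[of "poly P" t 0 "real j"] neg end0 jt cont by force
  then have L: "Z \<inter> {real j..t} \<noteq> {}" by (auto simp: Z_def)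
  have "\<exists>x\<ge>t. x \<le> real j + 1 \<and> poly P x = 0"
    using IVT'[of "poly P" t 0 "real j + 1"] neg end0 jt cont by force
  then have R: "Z \<inter> {t..real j + 1} \<noteq> {}" by (auto simp: Z_def)
  define r where "r = Max (Z \<inter> {real j..t})"
  define s where "s = Min (Z \<inter> {t..real j + 1})"
  have r: "r \<in> Z" "real j \<le> r" "r \<le> t" using Max_in[OF _ L] finZ unfolding r_def by auto
  have s: "s \<in> Z" "s \<le> real j + 1" "t \<le> s" using Min_in[OF _ R] finZ unfolding s_def by auto
  have tZ: "t \<notin> Z" using neg by (simp add: Z_def)
  have rs: "r < t" "t < s" using r s tZ by (auto simp: less_le)
  have noroot: "poly P x \<noteq> 0" if "r < x" "x < s" for x
  proof
    assume "poly P x = 0"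
    then have "x \<in> Z" by (simp add: Z_def)
    then show False
      using that r s Max_ge[of "Z \<inter> {real j..t}" x] Min_le[of "Z \<inter> {t..real j + 1}" x] finZ
      unfolding r_def[symmetric] s_def[symmetric] by (cases "x \<le> t") auto
  qed
  have negP: "poly P x < 0" if x: "r < x" "x < s" for x
  proof (rule ccontr)
    assume "\<not> poly P x < 0"
    then have pos: "poly P x > 0" using noroot[OF x] by simp
    show False
    proof (cases "x \<le> t")
      case True
      then obtain z where "x \<le> z" "z \<le> t" "poly P z = 0"
        using IVT2'[of "poly P" t 0 x] pos neg cont by force
      then show False using noroot[of z] x rs by auto
    next
      case False
      then obtain z where "t \<le> z" "z \<le> x" "poly P z = 0"
        using IVT'[of "poly P" t 0 x] pos neg cont by force
      then show False using noroot[of z] x rs by auto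
    qed
  qed
  have "[:- r, 1:] dvd P" using r(1) by (simp add: Z_def poly_eq_0_iff_dvd)
  then obtain P1 where P1: "P = [:- r, 1:] * P1" by (auto simp: dvd_def)
  have "poly P1 s = 0" using s(1) rs P1 by (auto simp: Z_def)
  then have "[:- s, 1:] dvd P1" by (simp add: poly_eq_0_iff_dvd)
  then obtain P' where "P1 = [:- s, 1:] * P'" by (auto simp: dvd_def)
  then have fac: "P = [:- r, 1:] * [:- s, 1:] * P'" using P1 by (simp only: mult.assoc)
  have int: "0 \<le> poly P' x" if x: "r < x" "x < s" for x
  proof -
    have "(x - r) * (x - s) * poly P' x < 0" using negP[OF x] unfolding fac by (simp add: algebra_simps)
    moreover have "(x - r) * (x - s) < 0" using x by (intro mult_pos_neg) auto
    ultimately show ?thesis by (simp add: mult_less_0_iff)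
  qed
  have "0 \<le> poly P' x" if x: "r \<le> x" "x \<le> s" for x
  proof -
    have "closure {r<..<s} = {r..s}" using rs by simp
    moreover have "closure {r<..<s} \<subseteq> {x. 0 \<le> poly P' x}"
      using int by (intro closure_minimal closed_Collect_le continuous_intros) auto
    ultimately show ?thesis using x by auto
  qed
  then show ?thesis using that[OF fac] r s rs by auto
qed

text \<open>
As long as \<open>P\<close> is negative somewhere in \<open>[0, n]\<close>, this happens strictly between consecutive integers, and
\<open>factor_two_roots\<close> removes a pair of roots without spoiling the hypothesis on the cofactor. A pair is recorded
by its midpoint \<open>z\<close> and its half-distance \<open>d\<close>, so that its quadratic factor is \<open>(x - z)\<^sup>2 - d\<^sup>2\<close>.
\<close>

lemma nonneg_on_integers_factorization:
  fixes P :: "real poly"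
  assumes "P \<noteq> 0" "\<And>j. j \<le> n \<Longrightarrow> 0 \<le> poly P (real j)"
  shows "\<exists>R zs. P = R * (\<Prod>(z, d)\<leftarrow>zs. [:- (z - d), 1:] * [:- (z + d), 1:]) \<and>
     degree R + 2 * length zs = degree P \<and>
     (\<forall>x\<in>{0..real n}. 0 \<le> poly R x) \<and>
     (\<forall>(z, d)\<in>set zs. 0 \<le> d \<and> d \<le> 1 / 2 \<and> (\<forall>j\<le>n. 0 \<le> (real j - z)\<^sup>2 - d\<^sup>2) )"
  using assms
proof (induction "degree P" arbitrary: P rule: less_induct)
  case less
  show ?case
  proof (cases "\<forall>x\<in>{0..real n}. 0 \<le> poly P x")
    case True
    then show ?thesis by (intro exI[of _ P] exI[of _ "[]"]) auto
  next
    case False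
    then obtain t where t: "0 \<le> t" "t \<le> real n" "poly P t < 0" by (auto simp: not_le)
    define j where "j = nat \<lfloor>t\<rfloor>"
    have jt: "real j \<le> t" "t < real j + 1" using t by (auto simp: j_def)
    have jn: "j \<le> n" using jt t by linarith
    have "real j \<noteq> t" using less.prems(2)[OF jn] t by auto
    then have jt': "real j < t" using jt by simp
    then have jn': "j + 1 \<le> n" using t by linarith
    obtain r s P' where f: "P = [:- r, 1:] * [:- s, 1:] * P'" "real j \<le> r" "r < s" "s \<le> real j + 1"
      and nn: "\<And>x. r \<le> x \<Longrightarrow> x \<le> s \<Longrightarrow> 0 \<le> poly P' x"
    proof (rule factor_two_roots[OF t(3) jt' jt(2)])
      show "0 \<le> poly P (real j)" using less.prems(2)[OF jn] .
      show "0 \<le> poly P (real j + 1)" using less.prems(2)[OF jn'] by (simp add: add.commute)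
    qed auto
    have P'0: "P' \<noteq> 0" using less.prems(1) f(1) by auto
    have deg: "degree P = degree P' + 2"
      unfolding f(1) using P'0 by (subst degree_mult_eq) (auto simp: degree_mult_eq)
    have sep: "real i \<le> r \<or> s \<le> real i" for i
    proof (cases "i \<le> j")
      case True then have "real i \<le> real j" by simp
      then show ?thesis using f by linarith
    next
      case False then have "real j + 1 \<le> real i" by linarith
      then show ?thesis using f by linarith
    qed
    have nn': "0 \<le> poly P' (real i)" if i: "i \<le> n" for i
    proof (cases "r \<le> real i \<and> real i \<le> s")
      case False
      have "0 \<le> (real i - r) * (real i - s) * poly P' (real i)"
        using less.prems(2)[OF i] unfolding f(1) by (simp add: algebra_simps)
      moreover have "0 < (real i - r) * (real i - s)"
        using False f(3) by (auto simp: not_le zero_less_mult_iff)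
      ultimately show ?thesis by (simp add: zero_le_mult_iff)
    qed (use nn in auto)
    obtain R zs where IH: "P' = R * (\<Prod>(z, d)\<leftarrow>zs. [:- (z - d), 1:] * [:- (z + d), 1:])"
      "degree R + 2 * length zs = degree P'" "\<forall>x\<in>{0..real n}. 0 \<le> poly R x"
      "\<forall>(z, d)\<in>set zs. 0 \<le> d \<and> d \<le> 1 / 2 \<and> (\<forall>j\<le>n. 0 \<le> (real j - z)\<^sup>2 - d\<^sup>2)"
      using less.hyps[of P', OF _ P'0 nn'] deg by auto
    define z where "z = (r + s) / 2"
    define d where "d = (s - r) / 2"
    have zd: "z - d = r" "z + d = s" by (auto simp: z_def d_def field_simps)
    have "0 \<le> (real i - z)\<^sup>2 - d\<^sup>2" for i
    proof -
      have "(real i - z)\<^sup>2 - d\<^sup>2 = (real i - r) * (real i - s)"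
        unfolding zd[symmetric] by (simp add: power2_eq_square algebra_simps)
      moreover have "0 \<le> (real i - r) * (real i - s)"
        using sep[of i] f(3) by (auto simp: zero_le_mult_iff)
      ultimately show ?thesis by simp
    qed
    moreover have "0 \<le> d" "d \<le> 1 / 2" using f by (auto simp: d_def)
    moreover have "P = R * (\<Prod>(z, d)\<leftarrow>(z, d) # zs. [:- (z - d), 1:] * [:- (z + d), 1:])"
      unfolding f(1) IH(1) by (simp only: list.map prod_list.Cons prod.case zd mult_ac)
    ultimately show ?thesis
      using IH deg by (intro exI[of _ R] exI[of _ "(z, d) # zs"]) auto
  qed
qed

section \<open>Interpolation at separated nodes\<close>

lemma lagrange_interpolation:
  fixes Q :: "real poly" and y :: "nat \<Rightarrow> real"
  assumes inj: "inj_on y {..<N}" and deg: "degree Q < N"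
  shows "poly Q x = (\<Sum>t<N. poly Q (y t) * (\<Prod>u\<in>{..<N} - {t}. (x - y u) / (y t - y u)))"
proof -
  define l where "l t = (\<Prod>u\<in>{..<N} - {t}. smult (1 / (y t - y u)) [:- y u, 1:])" for t
  define R where "R = (\<Sum>t<N. smult (poly Q (y t)) (l t))"
  have pl: "poly (l t) z = (\<Prod>u\<in>{..<N} - {t}. (z - y u) / (y t - y u))" for t z
    unfolding l_def poly_prod by (intro prod.cong) (auto simp: diff_divide_distrib)
  have degl: "degree (l t) \<le> N - 1" if "t < N" for t
  proof -
    have "degree (l t) \<le> (\<Sum>u\<in>{..<N} - {t}. degree (smult (1 / (y t - y u)) [:- y u, 1:]))"
      unfolding l_def by (rule order_trans[OF degree_prod_sum_le]) (simp_all only: o_def finite_Diff finite_lessThan order_refl)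
    also have "\<dots> \<le> (\<Sum>u\<in>{..<N} - {t}. 1)"
      by (intro sum_mono) (auto intro: order_trans[OF degree_smult_le])
    also have "\<dots> = N - 1" using that by simp
    finally show ?thesis .
  qed
  have "degree R \<le> N - 1"
    unfolding R_def by (intro degree_sum_le order_trans[OF degree_smult_le degl]) auto
  then have degR: "degree R < N" using deg by simp
  have on: "poly R (y t) = poly Q (y t)" if t: "t < N" for t
  proof -
    have "poly (l v) (y t) = (if v = t then 1 else 0)" if v: "v < N" for v
    proof (cases "v = t")
      case True
      have "y t \<noteq> y u" if "u \<in> {..<N} - {t}" for u
        using inj_onD[OF inj, of t u] t that by auto
      then show ?thesis using True unfolding pl by (auto intro!: prod.neutral)
    next
      case False
      then show ?thesis using t unfolding pl by (auto intro!: prod_zero)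
    qed
    then have "poly R (y t) = (\<Sum>v<N. if v = t then poly Q (y t) else 0)"
      unfolding R_def poly_sum by (intro sum.cong) auto
    then show ?thesis using t by simp
  qed
  have "Q = R"
  proof (rule poly_eqI_degree)
    show "degree Q < card (y ` {..<N})" "degree R < card (y ` {..<N})"
      using deg degR card_image[OF inj] by auto
  qed (use on in auto)
  then have "poly Q x = poly R x" by simp
  then show ?thesis by (simp add: R_def poly_sum pl)
qed

lemma prod_index_distances:
  assumes "t < N"
  shows "(\<Prod>u\<in>{..<N} - {t}. \<bar>real t - real u\<bar>) = fact t * fact (N - 1 - t)"
proof -
  have split: "{..<N} - {t} = {..<t} \<union> {t<..<N}" using assms by auto
  have "(\<Prod>u\<in>{..<t}. \<bar>real t - real u\<bar>) = (\<Prod>v=1..t. real v)"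
    by (rule prod.reindex_bij_witness[of _ "\<lambda>v. t - v" "\<lambda>u. t - u"]) (auto simp: of_nat_diff)
  moreover have "(\<Prod>u\<in>{t<..<N}. \<bar>real t - real u\<bar>) = (\<Prod>v=1..N-1-t. real v)"
    by (rule prod.reindex_bij_witness[of _ "\<lambda>v. t + v" "\<lambda>u. u - t"]) (auto simp: of_nat_diff)
  ultimately show ?thesis
    unfolding split by (subst prod.union_disjoint) (auto simp: fact_prod)
qed

text \<open>
If the nodes are at least as far apart as the points of an arithmetic progression with difference \<open>s\<close>, the
denominators in Lagrange's formula are at least those of the progression, whose product is \<open>t! (N - 1 - t)!\<close>
times a power of \<open>s\<close>. This is what makes nodes that avoid an exceptional set as good as equidistant ones.
\<close>

lemma separated_interpolation_bound:
  fixes Q :: "real poly" and y :: "nat \<Rightarrow> real" and s :: real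
  assumes s: "s > 0" and deg: "degree Q < N"
    and sep: "\<And>t u. t < N \<Longrightarrow> u < N \<Longrightarrow> s * \<bar>real t - real u\<bar> \<le> \<bar>y t - y u\<bar>"
  shows "\<bar>poly Q x\<bar> \<le> (\<Sum>t<N. \<bar>poly Q (y t)\<bar> *
           ((\<Prod>u\<in>{..<N} - {t}. \<bar>x - y u\<bar> / s) * (real ((N - 1) choose t) / fact (N - 1))))"
proof -
  have ne: "y t \<noteq> y u" if "t < N" "u < N" "t \<noteq> u" for t u
    using sep[OF that(1,2)] s that(3) by (auto simp: mult_le_0_iff)
  have inj: "inj_on y {..<N}" using ne by (auto intro!: inj_onI)
  have "\<bar>poly Q x\<bar> \<le> (\<Sum>t<N. \<bar>poly Q (y t)\<bar> * (\<Prod>u\<in>{..<N} - {t}. \<bar>x - y u\<bar> / \<bar>y t - y u\<bar>))"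
    unfolding lagrange_interpolation[OF inj deg, of x]
    by (rule order_trans[OF sum_abs]) (simp add: abs_mult abs_prod)
  also have "\<dots> \<le> (\<Sum>t<N. \<bar>poly Q (y t)\<bar> *
           ((\<Prod>u\<in>{..<N} - {t}. \<bar>x - y u\<bar> / s) * (real ((N - 1) choose t) / fact (N - 1))))"
  proof (intro sum_mono mult_left_mono)
    fix t assume "t \<in> {..<N}"
    then have t: "t < N" by simp
    have "(\<Prod>u\<in>{..<N} - {t}. \<bar>x - y u\<bar> / \<bar>y t - y u\<bar>)
        \<le> (\<Prod>u\<in>{..<N} - {t}. (\<bar>x - y u\<bar> / s) * (1 / \<bar>real t - real u\<bar>))"
    proof (rule prod_mono, intro conjI)
      fix u assume u: "u \<in> {..<N} - {t}"
      have "0 < s * \<bar>real t - real u\<bar>" using s u by simp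
      moreover have "s * \<bar>real t - real u\<bar> \<le> \<bar>y t - y u\<bar>" using sep t u by simp
      ultimately have "\<bar>x - y u\<bar> / \<bar>y t - y u\<bar> \<le> \<bar>x - y u\<bar> / (s * \<bar>real t - real u\<bar>)"
        by (intro divide_left_mono) auto
      then show "\<bar>x - y u\<bar> / \<bar>y t - y u\<bar> \<le> (\<bar>x - y u\<bar> / s) * (1 / \<bar>real t - real u\<bar>)" by simp
    qed simp
    also have "\<dots> = (\<Prod>u\<in>{..<N} - {t}. \<bar>x - y u\<bar> / s) * (1 / (fact t * fact (N - 1 - t)))"
      unfolding prod.distrib prod_dividef prod_index_distances[OF t] by simp
    also have "1 / (fact t * fact (N - 1 - t)) = real ((N - 1) choose t) / fact (N - 1)"
      using t by (subst binomial_fact) auto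
    finally show "(\<Prod>u\<in>{..<N} - {t}. \<bar>x - y u\<bar> / \<bar>y t - y u\<bar>)
       \<le> (\<Prod>u\<in>{..<N} - {t}. \<bar>x - y u\<bar> / s) * (real ((N - 1) choose t) / fact (N - 1))" .
  qed simp
  finally show ?thesis .
qed

text \<open>
Interpolation at a central point is stable. For exact distances \<open>s, 2 s, \<dots>, m s\<close> on both sides the product of all
distances is \<open>(m! s ^ m)\<^sup>2\<close>, which the denominators cancel up to a factor \<open>m\<close>. Here \<open>\<beta> s\<close> bounds the
additional displacement of the nodes; it multiplies each of the two half products by at most \<open>\<Prod> (1 + \<beta> / j)\<close>.
\<close>

lemma two_sided_interpolation_bound:
  fixes Q :: "real poly" and y :: "nat \<Rightarrow> real" and s \<beta> :: real
  assumes s: "s > 0" and \<beta>: "\<beta> \<ge> 0" and m: "m \<ge> 1" and deg: "degree Q < 2 * m"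
    and sep: "\<And>t u. t < 2 * m \<Longrightarrow> u < 2 * m \<Longrightarrow> s * \<bar>real t - real u\<bar> \<le> \<bar>y t - y u\<bar>"
    and left: "\<And>i. i < m \<Longrightarrow> \<bar>x - y (m - 1 - i)\<bar> \<le> s * (real (Suc i) + \<beta>)"
    and right: "\<And>i. i < m \<Longrightarrow> \<bar>x - y (m + i)\<bar> \<le> s * (real (Suc i) + \<beta>)"
  shows "\<bar>poly Q x\<bar> \<le> real m * (\<Prod>j<m. 1 + \<beta> / real (Suc j))\<^sup>2 * (\<Sum>t<2*m. \<bar>poly Q (y t)\<bar>)"
proof -
  \<comment> \<open>The nodes are numbered from left to right, so node \<open>t\<close> is the \<open>c t\<close>-th one counted from \<open>x\<close> outwards.\<close>
  define c where "c t = (if t < m then real (m - t) else real (t + 1 - m))" for t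
  define G where "G = (\<Prod>j<m. 1 + \<beta> / real (Suc j))"
  have c1: "c t \<ge> 1" if "t < 2 * m" for t using that by (auto simp: c_def)
  have dist: "\<bar>x - y t\<bar> / s \<le> c t + \<beta>" if t: "t < 2 * m" for t
  proof -
    have "\<bar>x - y t\<bar> \<le> s * (c t + \<beta>)"
    proof (cases "t < m")
      case True
      have e: "m - 1 - (m - 1 - t) = t" "Suc (m - 1 - t) = m - t" using True by auto
      show ?thesis using left[of "m - 1 - t"] True unfolding e by (simp add: c_def)
    next
      case False
      have e: "m + (t - m) = t" "Suc (t - m) = t + 1 - m" using False by auto
      show ?thesis using right[of "t - m"] False t unfolding e by (simp add: c_def)
    qed
    then show ?thesis using s by (simp add: divide_le_eq mult.commute)
  qed
  have half: "(\<Prod>j<m. real (Suc j) + \<beta>) = fact m * G"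
  proof -
    have "(\<Prod>j<m. real (Suc j) + \<beta>) = (\<Prod>j<m. real (Suc j) * (1 + \<beta> / real (Suc j)))"
      by (intro prod.cong) (auto simp: field_simps)
    also have "\<dots> = (\<Prod>j<m. real (Suc j)) * G" by (simp add: prod.distrib G_def)
    also have "(\<Prod>j<m. real (Suc j)) = fact m"
      unfolding fact_prod_Suc by (simp add: atLeast0LessThan)
    finally show ?thesis .
  qed
  have full: "(\<Prod>u<2*m. c u + \<beta>) = (fact m * G)\<^sup>2"
  proof -
    have "{..<2*m} = {..<m} \<union> {m..<2*m}" by auto
    then have "(\<Prod>u<2*m. c u + \<beta>) = (\<Prod>u<m. c u + \<beta>) * (\<Prod>u\<in>{m..<2*m}. c u + \<beta>)"
      by (simp add: prod.union_disjoint ivl_disj_int)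
    also have "(\<Prod>u<m. c u + \<beta>) = (\<Prod>j<m. real (Suc j) + \<beta>)"
      by (rule prod.reindex_bij_witness[of _ "\<lambda>j. m - 1 - j" "\<lambda>j. m - 1 - j"])
         (auto simp: c_def of_nat_diff)
    also have "(\<Prod>u\<in>{m..<2*m}. c u + \<beta>) = (\<Prod>j<m. real (Suc j) + \<beta>)"
      by (rule prod.reindex_bij_witness[of _ "\<lambda>j. m + j" "\<lambda>j. j - m"])
         (auto simp: c_def of_nat_diff)
    finally show ?thesis unfolding half by (simp add: power2_eq_square)
  qed
  have G0: "G \<ge> 0" using \<beta> by (auto simp: G_def intro!: prod_nonneg)
  have coef: "(\<Prod>u\<in>{..<2*m} - {t}. \<bar>x - y u\<bar> / s) * (real ((2*m - 1) choose t) / fact (2*m - 1))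
      \<le> real m * G\<^sup>2" if t: "t < 2 * m" for t
  proof -
    have "(\<Prod>u\<in>{..<2*m} - {t}. \<bar>x - y u\<bar> / s) \<le> (\<Prod>u\<in>{..<2*m} - {t}. c u + \<beta>)"
      using dist s by (intro prod_mono) auto
    also have "\<dots> \<le> (c t + \<beta>) * (\<Prod>u\<in>{..<2*m} - {t}. c u + \<beta>)"
    proof -
      have c0: "0 \<le> c u + \<beta>" if "u < 2 * m" for u using c1[OF that] \<beta> by linarith
      have "1 * (\<Prod>u\<in>{..<2*m} - {t}. c u + \<beta>) \<le> (c t + \<beta>) * (\<Prod>u\<in>{..<2*m} - {t}. c u + \<beta>)"
        using c1[OF t] \<beta> c0 by (intro mult_right_mono prod_nonneg) auto
      then show ?thesis by simp
    qed
    also have "\<dots> = (fact m * G)\<^sup>2"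
      unfolding full[symmetric] using t by (subst prod.remove[of _ t]) auto
    finally have 1: "(\<Prod>u\<in>{..<2*m} - {t}. \<bar>x - y u\<bar> / s) \<le> (fact m * G)\<^sup>2" .
    have "(2*m - 1) choose t \<le> (2*m - 1) choose ((2*m - 1) div 2)" by (rule binomial_maximum)
    also have "(2*m - 1) div 2 = m - 1" using m by (cases m) auto
    finally have "real ((2*m - 1) choose t) \<le> real ((2*m - 1) choose (m - 1))" by simp
    also have "\<dots> = fact (2*m - 1) / (fact (m - 1) * fact m)"
    proof -
      have "2*m - 1 - (m - 1) = m" using m by simp
      then show ?thesis using m by (subst binomial_fact) auto
    qed
    finally have 2: "real ((2*m - 1) choose t) / fact (2*m - 1) \<le> 1 / (fact (m - 1) * fact m)"
      by (simp add: divide_le_eq)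
    have "(\<Prod>u\<in>{..<2*m} - {t}. \<bar>x - y u\<bar> / s) * (real ((2*m - 1) choose t) / fact (2*m - 1))
        \<le> (fact m * G)\<^sup>2 * (1 / (fact (m - 1) * fact m))"
      using 1 2 by (intro mult_mono) auto
    also have "\<dots> = real m * G\<^sup>2"
    proof -
      have "fact m = real m * fact (m - 1)" using m by (intro fact_reduce) auto
      then show ?thesis using m by (simp add: power2_eq_square divide_simps)
    qed
    finally show ?thesis .
  qed
  have "\<bar>poly Q x\<bar> \<le> (\<Sum>t<2*m. \<bar>poly Q (y t)\<bar> *
     ((\<Prod>u\<in>{..<2*m} - {t}. \<bar>x - y u\<bar> / s) * (real ((2*m - 1) choose t) / fact (2*m - 1))))"
    by (rule separated_interpolation_bound[OF s deg sep])
  also have "\<dots> \<le> (\<Sum>t<2*m. \<bar>poly Q (y t)\<bar> * (real m * G\<^sup>2))"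
    using coef by (intro sum_mono mult_left_mono) auto
  finally show ?thesis
    unfolding G_def by (simp only: sum_distrib_right[symmetric] mult.commute)
qed

lemma power_le_exp_mult_fact: "real k ^ k \<le> exp (real k) * fact k"
proof -
  have "real k ^ k / fact k \<le> exp (real k)"
  proof -
    have "(\<Sum>i<Suc k. real k ^ i /\<^sub>R fact i) \<le> exp (real k)"
      unfolding exp_def by (rule sum_le_suminf[OF summable_exp_generic]) auto
    moreover have "real k ^ k /\<^sub>R fact k \<le> (\<Sum>i<Suc k. real k ^ i /\<^sub>R fact i)"
      by (rule member_le_sum) auto
    ultimately show ?thesis by (simp add: divide_inverse mult.commute)
  qed
  then show ?thesis by (simp add: divide_le_eq)
qed

text \<open>
Extrapolation from one side at distances comparable to the length \<open>k s\<close> of the node interval costs a fixed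
factor per degree: \<open>(4 k) ^ k\<close> from the numerators against \<open>k! / 2 ^ k\<close> from the denominators.
\<close>

lemma one_sided_interpolation_bound:
  fixes Q :: "real poly" and y :: "nat \<Rightarrow> real" and s :: real
  assumes s: "s > 0" and deg: "degree Q \<le> k"
    and sep: "\<And>t u. t \<le> k \<Longrightarrow> u \<le> k \<Longrightarrow> s * \<bar>real t - real u\<bar> \<le> \<bar>y t - y u\<bar>"
    and near: "\<And>t. t \<le> k \<Longrightarrow> \<bar>x - y t\<bar> \<le> 4 * real k * s"
  shows "\<bar>poly Q x\<bar> \<le> (8 * exp 1) ^ k * (\<Sum>t\<le>k. \<bar>poly Q (y t)\<bar>)"
proof -
  have coef: "(\<Prod>u\<in>{..<Suc k} - {t}. \<bar>x - y u\<bar> / s) * (real (k choose t) / fact k) \<le> (8 * exp 1) ^ k"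
    if t: "t < Suc k" for t
  proof -
    have "(\<Prod>u\<in>{..<Suc k} - {t}. \<bar>x - y u\<bar> / s) \<le> (\<Prod>u\<in>{..<Suc k} - {t}. 4 * real k)"
      using near s by (intro prod_mono) (auto simp: divide_le_eq)
    also have "\<dots> = 4 ^ k * real k ^ k" using t by (simp add: power_mult_distrib)
    also have "\<dots> \<le> 4 ^ k * (exp (real k) * fact k)"
      by (intro mult_left_mono power_le_exp_mult_fact) auto
    finally have 1: "(\<Prod>u\<in>{..<Suc k} - {t}. \<bar>x - y u\<bar> / s) \<le> 4 ^ k * (exp (real k) * fact k)" .
    have "real (k choose t) \<le> real (2 ^ k)"
      unfolding of_nat_le_iff by (rule binomial_le_pow2)
    then have 2: "real (k choose t) / fact k \<le> 2 ^ k / fact k" by (simp add: divide_right_mono)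
    have "(\<Prod>u\<in>{..<Suc k} - {t}. \<bar>x - y u\<bar> / s) * (real (k choose t) / fact k)
        \<le> 4 ^ k * (exp (real k) * fact k) * (2 ^ k / fact k)"
      using 1 2 by (intro mult_mono) auto
    also have "\<dots> = (4 * 2) ^ k * exp (real k)" unfolding power_mult_distrib by simp
    also have "\<dots> = (8 * exp 1) ^ k"
      by (simp add: power_mult_distrib exp_of_nat_mult[symmetric])
    finally show ?thesis .
  qed
  have "\<bar>poly Q x\<bar> \<le> (\<Sum>t<Suc k. \<bar>poly Q (y t)\<bar> *
     ((\<Prod>u\<in>{..<Suc k} - {t}. \<bar>x - y u\<bar> / s) * (real ((Suc k - 1) choose t) / fact (Suc k - 1))))"
    by (rule separated_interpolation_bound[OF s]) (use deg sep in auto)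
  also have "\<dots> \<le> (\<Sum>t<Suc k. \<bar>poly Q (y t)\<bar> * (8 * exp 1) ^ k)"
    using coef by (intro sum_mono mult_left_mono) auto
  finally show ?thesis
    by (simp only: sum_distrib_right[symmetric] lessThan_Suc_atMost mult.commute)
qed

section \<open>Averaging over families of nodes\<close>

text \<open>
Enumerates the positive distances at which an exceptional set is avoided: the \<open>t\<close>-th one (from 0) is displaced
by at most the number of forbidden distances.
\<close>

lemma enumerate_complement_bounds:
  fixes C :: "nat set"
  assumes fin: "finite C" and card: "card C \<le> b"
  shows "\<exists>g. strict_mono g \<and> (\<forall>t. g t \<notin> C \<and> t + 1 \<le> g t \<and> g t \<le> t + 1 + b)"
proof -
  define S where "S = - (insert 0 C)"
  define g where "g = enumerate S"
  have inf: "infinite S" unfolding S_def using fin by (intro Diff_infinite_finite[of _ UNIV, unfolded Compl_eq_Diff_UNIV[symmetric]]) auto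
  have sm: "strict_mono g" unfolding g_def strict_mono_def using inf by (auto intro: enumerate_mono)
  have inS: "g t \<in> S" for t unfolding g_def by (rule enumerate_in_set[OF inf])
  have lower: "t + 1 \<le> g t" for t
  proof (induction t)
    case 0
    have "g 0 \<noteq> 0" using inS[of 0] by (auto simp: S_def)
    then show ?case by simp
  next
    case (Suc t)
    have "g t < g (Suc t)" using sm by (simp add: strict_mono_def)
    then show ?case using Suc by simp
  qed
  have upper: "g t \<le> t + 1 + b" for t
  proof -
    have "{0..<g t} \<subseteq> insert 0 C \<union> g ` {..<t}"
    proof
      fix v assume v: "v \<in> {0..<g t}"
      show "v \<in> insert 0 C \<union> g ` {..<t}"
      proof (cases "v \<in> S")
        case True
        then obtain u where u: "v = g u" unfolding g_def using enumerate_Ex[OF _ True] inf by metis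
        then have "u < t" using v sm by (auto simp: strict_mono_less)
        then show ?thesis using u by auto
      qed (auto simp: S_def)
    qed
    then have "card {0..<g t} \<le> card (insert 0 C \<union> g ` {..<t})"
      using fin by (intro card_mono) auto
    also have "\<dots> \<le> card (insert 0 C) + card (g ` {..<t})" by (rule card_Un_le)
    also have "\<dots> \<le> Suc (card C) + t"
      using fin card_image_le[of "{..<t}" g] by (intro add_mono) (auto simp: card_insert_if)
    finally show ?thesis using card by simp
  qed
  have "g t \<notin> C" for t using inS[of t] by (simp add: S_def)
  with sm lower upper show ?thesis by blast
qed

lemma strict_mono_gap:
  fixes g :: "nat \<Rightarrow> nat"
  assumes "strict_mono g" "t \<le> u"
  shows "u - t \<le> g u - g t"
proof -
  have "g t + d \<le> g (t + d)" for d
  proof (induction d)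
    case (Suc d)
    have "g (t + d) < g (t + Suc d)" using assms(1) by (simp add: strict_mono_def)
    then show ?case using Suc by simp
  qed simp
  from this[of "u - t"] show ?thesis using assms(2) by simp
qed

lemma strict_mono_dist:
  fixes g :: "nat \<Rightarrow> nat"
  assumes "strict_mono g"
  shows "\<bar>real t - real u\<bar> \<le> \<bar>real (g t) - real (g u)\<bar>"
proof (cases "t \<le> u")
  case True
  have "g t \<le> g u" using assms True by (simp add: strict_mono_less_eq)
  then show ?thesis using strict_mono_gap[OF assms True] True by linarith
next
  case False
  then have "g u \<le> g t" using assms by (simp add: strict_mono_less_eq)
  then show ?thesis using strict_mono_gap[OF assms, of u t] False by linarith
qed

lemma sum_residue_classes:
  fixes h :: "nat \<Rightarrow> real"
  shows "(\<Sum>th<s. \<Sum>i<m. h (i * s + th)) = (\<Sum>r<m * s. h r)"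
proof -
  have "(\<Sum>th<s. \<Sum>i<m. h (i * s + th)) = (\<Sum>i<m. \<Sum>th<s. h (i * s + th))" by (rule sum.swap)
  also have "\<dots> = (\<Sum>i<m. sum h {i * s..<i * s + s})"
  proof (rule sum.cong[OF refl])
    fix i show "(\<Sum>th<s. h (i * s + th)) = sum h {i * s..<i * s + s}"
      by (rule sum.reindex_bij_witness[of _ "\<lambda>r. r - i * s" "\<lambda>th. i * s + th"]) auto
  qed
  also have "\<dots> = (\<Sum>r<m * s. h r)" by (rule sum.nat_group)
  finally show ?thesis .
qed

text \<open>
The admissible distances with index congruent to a fixed \<open>th\<close> modulo \<open>s\<close> are separated like multiples of \<open>s\<close>, so they
serve as nodes. As \<open>th\<close> runs through the \<open>s\<close> residue classes every point is used at most once on each side, hence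
the sum of the \<open>s\<close> interpolation bounds is controlled by a single sum over \<open>A\<close>; this is the gain \<open>s\<close> on
the left-hand side. Here \<open>W\<close> is the weight of \<open>x\<close>, which \<open>E\<close> compares with the weights of the nodes.
\<close>

lemma averaged_two_sided_bound:
  fixes Q :: "real poly" and x :: int and w :: "int \<Rightarrow> real" and A :: "int set"
  assumes s: "s \<ge> 1" and m: "m \<ge> 1" and deg: "degree Q < 2 * m"
    and gR: "strict_mono gR" "\<And>t. t + 1 \<le> gR t" "\<And>t. gR t \<le> t + 1 + b"
    and gL: "strict_mono gL" "\<And>t. t + 1 \<le> gL t" "\<And>t. gL t \<le> t + 1 + b"
    and A: "finite A" "\<And>y. y \<in> A \<Longrightarrow> 0 \<le> w y"
    and R: "\<And>r. r < m * s \<Longrightarrow> x + int (gR r) \<in> A \<and> W \<le> E * w (x + int (gR r))"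
    and L: "\<And>r. r < m * s \<Longrightarrow> x - int (gL r) \<in> A \<and> W \<le> E * w (x - int (gL r))"
    and E: "E \<ge> 0" and W: "W \<ge> 0"
  shows "real s * (W * \<bar>poly Q x\<bar>) \<le>
    2 * real m * (\<Prod>j<m. 1 + (real b / real s) / real (Suc j))\<^sup>2 * E * (\<Sum>y\<in>A. w y * \<bar>poly Q y\<bar>)"
proof -
  define G where "G = (\<Prod>j<m. 1 + (real b / real s) / real (Suc j))"
  define f where "f y = \<bar>poly Q (real_of_int y)\<bar>" for y :: int
  define S where "S = (\<Sum>y\<in>A. w y * f y)"
  have pt: "f x \<le> real m * G\<^sup>2 * ((\<Sum>i<m. f (x - int (gL (i * s + (s - 1 - th))))) +
      (\<Sum>i<m. f (x + int (gR (i * s + th)))))" if th: "th < s" for th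
  proof -
    \<comment> \<open>The complementary class \<open>s - 1 - th\<close> on the left keeps the two innermost nodes at least \<open>s\<close> apart.\<close>
    define z where "z t = (if t < m then x - int (gL ((m - 1 - t) * s + (s - 1 - th)))
                           else x + int (gR ((t - m) * s + th)))" for t
    define y where "y t = real_of_int (z t)" for t
    have mult: "real s * (real i - real j) = real (i * s + c) - real (j * s + c)" for i j c
      by (simp add: algebra_simps)
    have sep_le: "real s * \<bar>real t - real u\<bar> \<le> \<bar>y t - y u\<bar>" if tu: "t < 2 * m" "u < 2 * m" "t \<le> u" for t u
    proof -
      consider "u < m" | "m \<le> t" | "t < m" "m \<le> u" by linarith
      then show ?thesis
      proof cases
        case 1
        have "real s * \<bar>real t - real u\<bar> =
          \<bar>real ((m-1-t) * s + (s - 1 - th)) - real ((m-1-u) * s + (s - 1 - th))\<bar>"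
          using 1 tu unfolding mult[symmetric] by (simp add: abs_mult of_nat_diff)
        also have "\<dots> \<le> \<bar>real (gL ((m-1-t) * s + (s - 1 - th))) - real (gL ((m-1-u) * s + (s - 1 - th)))\<bar>"
          by (rule strict_mono_dist[OF gL(1)])
        also have "\<dots> = \<bar>y t - y u\<bar>"
          using 1 tu by (simp add: y_def z_def abs_minus_commute)
        finally show ?thesis .
      next
        case 2
        have "real s * \<bar>real t - real u\<bar> = \<bar>real ((t-m) * s + th) - real ((u-m) * s + th)\<bar>"
          using 2 tu unfolding mult[symmetric] by (simp add: abs_mult of_nat_diff)
        also have "\<dots> \<le> \<bar>real (gR ((t-m) * s + th)) - real (gR ((u-m) * s + th))\<bar>"
          by (rule strict_mono_dist[OF gR(1)])
        also have "\<dots> = \<bar>y t - y u\<bar>"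
          using 2 tu by (simp add: y_def z_def)
        finally show ?thesis .
      next
        case 3
        have 1: "(m-1-t) * s + (s - 1 - th) + 1 \<le> gL ((m-1-t) * s + (s - 1 - th))"
          and 2: "(u-m) * s + th + 1 \<le> gR ((u-m) * s + th)" using gL(2) gR(2) by auto
        have "(u - t) * s = (m - 1 - t) * s + (u - m) * s + s"
        proof -
          have "u - t = (m - 1 - t) + (u - m) + 1" using 3 by simp
          then show ?thesis by (simp only: add_mult_distrib mult_1)
        qed
        then have "(u - t) * s \<le> gL ((m-1-t) * s + (s - 1 - th)) + gR ((u-m) * s + th)"
          using 1 2 th by linarith
        then have "real ((u - t) * s) \<le> real (gL ((m-1-t) * s + (s - 1 - th)) + gR ((u-m) * s + th))"
          unfolding of_nat_le_iff .
        moreover have "y u - y t = real (gL ((m-1-t) * s + (s - 1 - th)) + gR ((u-m) * s + th))"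
          using 3 by (simp add: y_def z_def)
        moreover have "real s * \<bar>real t - real u\<bar> = real ((u - t) * s)"
          using tu by (simp add: of_nat_diff)
        ultimately show ?thesis by linarith
      qed
    qed
    have sep: "real s * \<bar>real t - real u\<bar> \<le> \<bar>y t - y u\<bar>" if "t < 2 * m" "u < 2 * m" for t u
      using sep_le[of t u] sep_le[of u t] that by (metis abs_minus_commute nat_le_linear)
    have reach: "real (g (i * s + c)) \<le> real s * (real (Suc i) + real b / real s)"
      if "\<And>t. g t \<le> t + 1 + b" "c < s" for g :: "nat \<Rightarrow> nat" and i c
    proof -
      have "g (i * s + c) \<le> i * s + s + b" using that(1)[of "i * s + c"] that(2) by linarith
      then have "real (g (i * s + c)) \<le> real (i * s + s + b)" unfolding of_nat_le_iff .
      also have "\<dots> = real s * (real (Suc i) + real b / real s)" using s by (simp add: field_simps)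
      finally show ?thesis .
    qed
    have "f x \<le> real m * G\<^sup>2 * (\<Sum>t<2*m. \<bar>poly Q (y t)\<bar>)"
      unfolding f_def G_def
    proof (rule two_sided_interpolation_bound[where s = "real s"])
      fix i assume i: "i < m"
      have e: "m - 1 - (m - 1 - i) = i" using i by simp
      show "\<bar>real_of_int x - y (m - 1 - i)\<bar> \<le> real s * (real (Suc i) + real b / real s)"
        using reach[OF gL(3), of "s - 1 - th" i] i th e by (simp add: y_def z_def)
      show "\<bar>real_of_int x - y (m + i)\<bar> \<le> real s * (real (Suc i) + real b / real s)"
        using reach[OF gR(3), of "th" i] i th by (simp add: y_def z_def)
    qed (use s m deg sep in auto)
    also have "(\<Sum>t<2*m. \<bar>poly Q (y t)\<bar>) = (\<Sum>t<m. \<bar>poly Q (y t)\<bar>) + (\<Sum>t\<in>{m..<2*m}. \<bar>poly Q (y t)\<bar>)"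
    proof -
      have "{..<2*m} = {..<m} \<union> {m..<2*m}" by auto
      then show ?thesis by (simp add: sum.union_disjoint ivl_disj_int)
    qed
    also have "(\<Sum>t<m. \<bar>poly Q (y t)\<bar>) = (\<Sum>i<m. f (x - int (gL (i * s + (s - 1 - th)))))"
      by (rule sum.reindex_bij_witness[of _ "\<lambda>i. m - 1 - i" "\<lambda>i. m - 1 - i"]) (auto simp: f_def y_def z_def)
    also have "(\<Sum>t\<in>{m..<2*m}. \<bar>poly Q (y t)\<bar>) = (\<Sum>i<m. f (x + int (gR (i * s + th))))"
      by (rule sum.reindex_bij_witness[of _ "\<lambda>i. m + i" "\<lambda>t. t - m"]) (auto simp: f_def y_def z_def)
    finally show ?thesis .
  qed
  have f0: "f y \<ge> 0" for y by (simp add: f_def)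
  have G0: "0 \<le> real m * G\<^sup>2" by simp
  \<comment> \<open>Along an injective family of points of \<open>A\<close> the weight \<open>W\<close> may be replaced by the local weights.\<close>
  have coll: "W * (\<Sum>r<m * s. f (z r)) \<le> E * S"
    if inj: "inj_on z {..<m * s}" and z: "\<And>r. r < m * s \<Longrightarrow> z r \<in> A \<and> W \<le> E * w (z r)" for z :: "nat \<Rightarrow> int"
  proof -
    have "W * (\<Sum>r<m * s. f (z r)) \<le> (\<Sum>r<m * s. E * (w (z r) * f (z r)))"
      unfolding sum_distrib_left
      using z f0 by (intro sum_mono) (auto simp: mult.assoc[symmetric] intro!: mult_right_mono)
    also have "\<dots> = E * (\<Sum>y\<in>z ` {..<m * s}. w y * f y)"
      by (simp add: sum.reindex[OF inj] sum_distrib_left)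
    also have "\<dots> \<le> E * S"
      unfolding S_def using E A f0 z by (intro mult_left_mono sum_mono2) auto
    finally show ?thesis .
  qed
  have injR: "inj_on (\<lambda>r. x + int (gR r)) {..<m * s}" and injL: "inj_on (\<lambda>r. x - int (gL r)) {..<m * s}"
    using gR(1) gL(1) by (auto intro!: inj_onI simp: strict_mono_eq)
  have "real s * f x = (\<Sum>th<s. f x)" by simp
  also have "\<dots> \<le> (\<Sum>th<s. real m * G\<^sup>2 * ((\<Sum>i<m. f (x - int (gL (i * s + (s - 1 - th))))) +
      (\<Sum>i<m. f (x + int (gR (i * s + th))))))" by (intro sum_mono pt) auto
  also have "\<dots> = real m * G\<^sup>2 * ((\<Sum>th<s. \<Sum>i<m. f (x - int (gL (i * s + (s - 1 - th))))) +
      (\<Sum>th<s. \<Sum>i<m. f (x + int (gR (i * s + th)))))"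
    by (simp only: sum_distrib_left[symmetric] sum.distrib)
  also have "(\<Sum>th<s. \<Sum>i<m. f (x - int (gL (i * s + (s - 1 - th)))))
      = (\<Sum>th<s. \<Sum>i<m. f (x - int (gL (i * s + th))))"
    by (rule sum.reindex_bij_witness[of _ "\<lambda>th. s - 1 - th" "\<lambda>th. s - 1 - th"]) auto
  finally have "real s * f x \<le> real m * G\<^sup>2 * ((\<Sum>r<m * s. f (x - int (gL r))) + (\<Sum>r<m * s. f (x + int (gR r))))"
    unfolding sum_residue_classes[of "\<lambda>r. f (x - int (gL r))"] sum_residue_classes[of "\<lambda>r. f (x + int (gR r))"] .
  then have "W * (real s * f x) \<le> W * (real m * G\<^sup>2 * ((\<Sum>r<m * s. f (x - int (gL r))) + (\<Sum>r<m * s. f (x + int (gR r)))))"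
    using W by (rule mult_left_mono)
  also have "\<dots> = real m * G\<^sup>2 * (W * (\<Sum>r<m * s. f (x - int (gL r))) + W * (\<Sum>r<m * s. f (x + int (gR r))))"
    by (simp add: algebra_simps)
  also have "\<dots> \<le> real m * G\<^sup>2 * (E * S + E * S)"
    using coll[OF injR R] coll[OF injL L] by (intro mult_left_mono add_mono) auto
  finally show ?thesis by (simp add: f_def S_def G_def algebra_simps)
qed

text \<open>
The same averaging with all nodes in direction \<open>e\<close>. The first \<open>k s\<close> admissible points are skipped, so that the
weight of every node can exceed the weight of \<open>x\<close> by the factor \<open>(8 e) ^ k\<close> that the extrapolation costs.
\<close>

lemma averaged_one_sided_bound:
  fixes Q :: "real poly" and x e :: int and w :: "int \<Rightarrow> real" and A :: "int set"
  assumes s: "s \<ge> 1" and k: "k \<ge> 2" and deg: "degree Q \<le> k" and e: "e = 1 \<or> e = - 1"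
    and g: "strict_mono g" "\<And>t. g t \<le> t + 1 + b" and b: "b \<le> k * s"
    and A: "finite A" "\<And>y. y \<in> A \<Longrightarrow> 0 \<le> w y"
    and R: "\<And>r. k * s \<le> r \<Longrightarrow> r < (2 * k + 1) * s \<Longrightarrow>
      x + e * int (g r) \<in> A \<and> (8 * exp 1) ^ k * W \<le> w (x + e * int (g r))"
    and W: "W \<ge> 0"
  shows "real s * (W * \<bar>poly Q x\<bar>) \<le> (\<Sum>y\<in>A. w y * \<bar>poly Q y\<bar>)"
proof -
  define f where "f y = \<bar>poly Q (real_of_int y)\<bar>" for y :: int
  define S where "S = (\<Sum>y\<in>A. w y * f y)"
  have ab: "\<bar>real_of_int e\<bar> = 1" using e by auto
  have pt: "f x \<le> (8 * exp 1) ^ k * (\<Sum>i\<le>k. f (x + e * int (g ((k + i) * s + th))))"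
    if th: "th < s" for th
  proof -
    define y where "y i = real_of_int (x + e * int (g ((k + i) * s + th)))" for i
    have dist: "\<bar>y t - y u\<bar> = \<bar>real (g ((k + t) * s + th)) - real (g ((k + u) * s + th))\<bar>" for t u
    proof -
      have "y t - y u = e * (real (g ((k + t) * s + th)) - real (g ((k + u) * s + th)))"
        by (simp add: y_def algebra_simps)
      then show ?thesis by (simp add: abs_mult ab)
    qed
    have "\<bar>poly Q x\<bar> \<le> (8 * exp 1) ^ k * (\<Sum>i\<le>k. \<bar>poly Q (y i)\<bar>)"
    proof (rule one_sided_interpolation_bound[where s = "real s"])
      fix t u assume "t \<le> k" "u \<le> k"
      have "real s * \<bar>real t - real u\<bar> = \<bar>real ((k + t) * s + th) - real ((k + u) * s + th)\<bar>"
      proof -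
        have "real ((k + t) * s + th) - real ((k + u) * s + th) = real s * (real t - real u)"
          by (simp add: algebra_simps)
        then show ?thesis by (simp add: abs_mult)
      qed
      also have "\<dots> \<le> \<bar>y t - y u\<bar>" unfolding dist by (rule strict_mono_dist[OF g(1)])
      finally show "real s * \<bar>real t - real u\<bar> \<le> \<bar>y t - y u\<bar>" .
    next
      fix t assume t: "t \<le> k"
      have "g ((k + t) * s + th) \<le> (k + t) * s + s + k * s"
        using g(2)[of "(k + t) * s + th"] th b by linarith
      also have "\<dots> = (k + t + 1 + k) * s" by (simp add: algebra_simps)
      also have "\<dots> \<le> 4 * k * s" using t k by (intro mult_right_mono) auto
      finally have "real (g ((k + t) * s + th)) \<le> real (4 * k * s)" unfolding of_nat_le_iff .
      moreover have "\<bar>real_of_int x - y t\<bar> = real (g ((k + t) * s + th))"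
        by (simp add: y_def abs_mult ab)
      ultimately show "\<bar>real_of_int x - y t\<bar> \<le> 4 * real k * real s" by simp
    qed (use s deg in auto)
    then show ?thesis by (simp add: f_def y_def)
  qed
  define I where "I = {k * s..<(2 * k + 1) * s}"
  define z where "z r = x + e * int (g r)" for r
  have f0: "f y \<ge> 0" for y by (simp add: f_def)
  have grp: "(\<Sum>th<s. \<Sum>i\<le>k. h ((k + i) * s + th)) = (\<Sum>r\<in>I. h r)" for h :: "nat \<Rightarrow> real"
  proof -
    have "(\<Sum>th<s. \<Sum>i\<le>k. h ((k + i) * s + th)) = (\<Sum>th<s. \<Sum>i<Suc k. h (k * s + (i * s + th)))"
      unfolding lessThan_Suc_atMost by (simp add: algebra_simps)
    also have "\<dots> = (\<Sum>r<Suc k * s. h (k * s + r))"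
      by (rule sum_residue_classes[of "\<lambda>r. h (k * s + r)"])
    also have "\<dots> = (\<Sum>r\<in>I. h r)"
      unfolding I_def
      by (rule sum.reindex_bij_witness[of _ "\<lambda>r. r - k * s" "\<lambda>r. k * s + r"]) (auto simp: algebra_simps)
    finally show ?thesis .
  qed
  have injz: "inj_on z I" using g(1) e by (auto intro!: inj_onI simp: z_def strict_mono_eq)
  have "real s * f x = (\<Sum>th<s. f x)" by simp
  also have "\<dots> \<le> (\<Sum>th<s. (8 * exp 1) ^ k * (\<Sum>i\<le>k. f (z ((k + i) * s + th))))"
    unfolding z_def by (intro sum_mono pt) auto
  also have "\<dots> = (8 * exp 1) ^ k * (\<Sum>r\<in>I. f (z r))"
    unfolding sum_distrib_left[symmetric] grp[of "\<lambda>r. f (z r)"] ..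
  finally have "W * (real s * f x) \<le> W * ((8 * exp 1) ^ k * (\<Sum>r\<in>I. f (z r)))"
    using W by (rule mult_left_mono)
  also have "\<dots> = (\<Sum>r\<in>I. ((8 * exp 1) ^ k * W) * f (z r))"
    unfolding sum_distrib_left by (intro sum.cong) (auto simp: mult_ac)
  also have "\<dots> \<le> (\<Sum>r\<in>I. w (z r) * f (z r))"
    using R f0 by (intro sum_mono mult_right_mono) (auto simp: I_def z_def)
  also have "\<dots> = (\<Sum>y\<in>z ` I. w y * f y)" by (simp add: sum.reindex[OF injz])
  also have "\<dots> \<le> S"
    unfolding S_def using A f0 R by (intro sum_mono2) (auto simp: I_def z_def)
  finally show ?thesis by (simp add: f_def S_def mult_ac)
qed

section \<open>A Remez inequality for binomial weights\<close>

text \<open>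
From \<open>1 + y\<^sup>2 / 2 \<le> exp y\<close> and \<open>\<Sum> 1 / sqrt j \<le> 2 sqrt m\<close>. The bound \<open>sqrt (\<beta> m)\<close> is far from sharp, but it has
the size \<open>k / h\<close> of the other losses for \<open>\<beta>\<close> of order \<open>k / h\<^sup>2\<close> and \<open>m\<close> of order \<open>k\<close>.
\<close>

lemma prod_one_plus_inverse_le_exp:
  assumes "\<beta> \<ge> 0"
  shows "(\<Prod>j<m. 1 + \<beta> / real (Suc j)) \<le> exp (2 * sqrt (2 * \<beta> * real m))"
proof -
  have root: "(\<Sum>j<m. 1 / sqrt (real (Suc j))) \<le> 2 * sqrt (real m)" for m
  proof (induction m)
    case (Suc m)
    have "1 / sqrt (real (Suc m)) \<le> 2 * (sqrt (real (Suc m)) - sqrt (real m))"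
    proof -
      define x y where "x = sqrt (real m)" and "y = sqrt (real (Suc m))"
      have xy: "0 \<le> x" "x \<le> y" "y > 0" by (auto simp: x_def y_def)
      have "y * y - x * x = 1" by (simp add: x_def y_def)
      moreover have "0 \<le> (y - x) * (y - x)" by simp
      ultimately have "1 \<le> 2 * (y - x) * y" using xy by (simp add: algebra_simps)
      then show ?thesis unfolding x_def[symmetric] y_def[symmetric] using xy by (simp add: divide_le_eq)
    qed
    then show ?case using Suc by simp
  qed simp
  have "(\<Prod>j<m. 1 + \<beta> / real (Suc j)) \<le> (\<Prod>j<m. exp (sqrt (2 * \<beta>) * (1 / sqrt (real (Suc j)))))"
  proof (rule prod_mono, intro conjI)
    fix j
    define y where "y = sqrt (2 * \<beta>) * (1 / sqrt (real (Suc j)))"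
    have y0: "y \<ge> 0" using assms by (simp add: y_def)
    have "y\<^sup>2 / 2 = \<beta> / real (Suc j)" using assms by (simp add: y_def power_mult_distrib power_divide del: of_nat_Suc)
    then have "1 + \<beta> / real (Suc j) = 1 + y\<^sup>2 / 2" by (simp only:)
    also have "\<dots> \<le> 1 + y + y\<^sup>2 / 2" using y0 by simp
    also have "\<dots> \<le> exp y" by (rule exp_lower_Taylor_quadratic[OF y0])
    finally show "1 + \<beta> / real (Suc j) \<le> exp (sqrt (2 * \<beta>) * (1 / sqrt (real (Suc j))))"
      by (simp add: y_def)
  qed (use assms in simp)
  also have "\<dots> = exp (sqrt (2 * \<beta>) * (\<Sum>j<m. 1 / sqrt (real (Suc j))))"
    by (simp only: sum_distrib_left exp_sum[OF finite_lessThan])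
  also have "\<dots> \<le> exp (sqrt (2 * \<beta>) * (2 * sqrt (real m)))"
    using root[of m] assms by (simp only: exp_le_cancel_iff) (intro mult_left_mono, auto)
  finally show ?thesis by (simp add: real_sqrt_mult mult_ac)
qed

lemma distances_avoiding_set:
  fixes B :: "int set" and e x :: int
  assumes "finite B" "card B \<le> b" "e = 1 \<or> e = - 1"
  obtains g where "strict_mono g" "\<And>t. x + e * int (g t) \<notin> B" "\<And>t. t + 1 \<le> g t" "\<And>t. g t \<le> t + 1 + b"
proof -
  define C where "C = (\<lambda>d. x + e * int d) -` B"
  have inj: "inj_on (\<lambda>d. x + e * int d) A" for A using assms(3) by (auto intro!: inj_onI)
  have "finite C" unfolding C_def by (rule finite_vimageI[OF assms(1) inj])
  moreover have "card C \<le> b"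
    using card_inj_on_le[OF inj[of C] _ assms(1)] assms(2) by (auto simp: C_def)
  ultimately obtain g where "strict_mono g" "\<forall>t. g t \<notin> C \<and> t + 1 \<le> g t \<and> g t \<le> t + 1 + b"
    using enumerate_complement_bounds by blast
  then show ?thesis using that[of g] by (auto simp: C_def)
qed

text \<open>
All lengths are measured by \<open>h\<close>: the exceptional set has about \<open>k h\<close> points, the nodes near the mean have spacing
\<open>h\<^sup>3\<close>, the tails begin at distance of order \<open>k h\<^sup>4\<close> from the mean, and the variance is \<open>k h\<^sup>8\<close>.
\<close>

locale binomial_scale =
  fixes n k :: nat and p h :: real
  assumes p: "0 < p" "p < 1" and k: "k \<ge> 2" and h: "h \<ge> 3"
    and scale: "real n * p * (1 - p) = real k * h ^ 8"
begin

definition w :: "int \<Rightarrow> real" where "w y = binom_weight n p (nat y)"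

lemma w_nonneg: "0 \<le> w y"
  using p by (simp add: w_def binom_weight_nonneg)

lemma h_bounds: "h ^ 4 \<ge> 81" "2 * h \<le> h ^ 3" "h ^ 3 + 2 * h \<le> h ^ 4" "4 * h \<le> h ^ 4" "27 \<le> h ^ 3"
proof -
  have h9: "9 \<le> h ^ 2" using power_mono[of 3 h 2] h by simp
  show "h ^ 4 \<ge> 81" using power_mono[of 3 h 4] h by simp
  show h27: "27 \<le> h ^ 3" using power_mono[of 3 h 3] h by simp
  have "9 * h \<le> h ^ 2 * h" using h9 h by (intro mult_right_mono) auto
  also have "h ^ 2 * h = h ^ 3" by (simp add: power2_eq_square power3_eq_cube)
  finally have 3: "9 * h \<le> h ^ 3" .
  then show "2 * h \<le> h ^ 3" using h by linarith
  have "h ^ 3 * 3 \<le> h ^ 3 * h" using h by (intro mult_left_mono) auto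
  also have "h ^ 3 * h = h ^ 4" by (simp add: eval_nat_numeral)
  finally have 4: "h ^ 3 * 3 \<le> h ^ 4" .
  show "h ^ 3 + 2 * h \<le> h ^ 4" "4 * h \<le> h ^ 4" using 3 4 h by linarith+
qed

lemma v_bounds: "real n * p * (1 - p) \<le> real n * p" "real n * p * (1 - p) \<le> real n - real n * p"
proof -
  have "real n * p * (1 - p) \<le> real n * p * 1" using p by (intro mult_left_mono) auto
  then show "real n * p * (1 - p) \<le> real n * p" by simp
  have "real n * (1 - p) * p \<le> real n * (1 - p) * 1" using p by (intro mult_left_mono) auto
  then show "real n * p * (1 - p) \<le> real n - real n * p" by (simp add: algebra_simps)
qed

text \<open>
Near the mean the logarithm of the weights changes by at most \<open>42 / h\<^sup>4\<close> per step, and the nodes are within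
\<open>2 k h\<^sup>3\<close> of \<open>x\<close>, so the weights agree up to \<open>exp (84 k / h)\<close>. The displacement of the nodes costs another
\<open>exp (12 k / h)\<close>.
\<close>

lemma bulk_point_bound:
  fixes Q :: "real poly" and B :: "int set" and x :: int
  assumes deg: "degree Q \<le> k" and B: "finite B" "real (card B) \<le> 2 * real k * h"
    and x: "0 \<le> x" "x \<le> int n" "\<bar>x - real n * p\<bar> \<le> 20 * real k * h ^ 4"
  shows "h ^ 3 / 2 * (w x * \<bar>poly Q x\<bar>)
    \<le> 2 * real k * exp (96 * real k / h) * (\<Sum>y\<in>{0..int n} - B. w y * \<bar>poly Q y\<bar>)"
proof -
  define b where "b = card B"
  define s where "s = nat \<lfloor>h ^ 3\<rfloor>"
  define m where "m = k div 2 + 1"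
  define U where "U = 21 * real k * h ^ 4"
  define v where "v = real n * p * (1 - p)"
  define S where "S = (\<Sum>y\<in>{0..int n} - B. w y * \<bar>poly Q y\<bar>)"
  have k0: "real k \<ge> 2" using k by simp
  have m: "m \<ge> 1" "m \<le> k" "k < 2 * m" using k by (auto simp: m_def)
  have hp: "h > 0" using h by simp
  have s: "real s \<le> h ^ 3" "h ^ 3 / 2 \<le> real s" "s \<ge> 1"
    using h_bounds(5) unfolding s_def by linarith+
  have v_eq: "v = real k * h ^ 8" using scale by (simp add: v_def)
  have v0: "v > 0" using k0 hp by (simp add: v_eq)
  have U: "0 \<le> U" "U \<le> v / 2"
  proof -
    have "42 * (real k * h ^ 4) \<le> h ^ 4 * (real k * h ^ 4)"
      using h_bounds(1) hp by (intro mult_right_mono) auto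
    also have "\<dots> = v" by (simp add: v_eq eval_nat_numeral)
    finally show "U \<le> v / 2" by (simp add: U_def)
  qed (use hp in \<open>simp add: U_def\<close>)
  have Uv: "2 * U / v = 42 / h ^ 4"
    using k0 hp by (simp add: U_def v_eq field_simps flip: power_add)
  have S0: "S \<ge> 0" unfolding S_def using w_nonneg by (intro sum_nonneg) auto
  have near: "x + e * int d \<in> {0..int n} - B \<and> w x \<le> exp (84 * real k / h) * w (x + e * int d)"
    if e: "e = 1 \<or> e = - 1" and d: "x + e * int d \<notin> B" "d \<le> m * s + b" for e d
  proof -
    have "real d \<le> real (m * s + b)" using d(2) by (simp only: of_nat_le_iff)
    also have "\<dots> = real m * real s + real b" by simp
    also have "\<dots> \<le> real k * h ^ 3 + 2 * real k * h"
      using m s B hp unfolding b_def by (intro add_mono mult_mono) auto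
    finally have d1: "real d \<le> real k * (h ^ 3 + 2 * h)" by (simp add: algebra_simps)
    have d2: "real d \<le> real k * h ^ 4"
      using h_bounds(3) by (intro order_trans[OF d1] mult_left_mono) auto
    have d3: "real d \<le> real k * (2 * h ^ 3)"
      using h_bounds(2) by (intro order_trans[OF d1] mult_left_mono) auto
    define y where "y = x + e * int d"
    have dist: "\<bar>real_of_int x - real_of_int y\<bar> = real d"
      using e by (auto simp: y_def)
    have yU: "\<bar>real_of_int y - real n * p\<bar> \<le> U" "\<bar>real_of_int x - real n * p\<bar> \<le> U"
      using dist d2 x(3) unfolding U_def by linarith+
    have "U \<le> real n * p" "U \<le> real n - real n * p"
      using U v_bounds v0 unfolding v_def by linarith+
    then have "0 \<le> real_of_int y" "real_of_int y \<le> real n" using yU by linarith+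
    then have yn: "0 \<le> y" "y \<le> int n" by linarith+
    have rx: "real (nat x) = real_of_int x" "real (nat y) = real_of_int y" using x yn by auto
    have "w x \<le> exp (2 * U / v * \<bar>real (nat x) - real (nat y)\<bar>) * w y"
      unfolding w_def using x yn yU rx U v0
      by (intro binom_weight_bulk_ratio[OF p v_def]) auto
    also have "\<dots> \<le> exp (84 * real k / h) * w y"
    proof (intro mult_right_mono w_nonneg)
      have "2 * U / v * real d \<le> 42 / h ^ 4 * (real k * (2 * h ^ 3))"
        unfolding Uv using d3 hp by (intro mult_left_mono) auto
      also have "\<dots> = 84 * real k / h" using hp by (simp add: field_simps eval_nat_numeral)
      finally show "exp (2 * U / v * \<bar>real (nat x) - real (nat y)\<bar>) \<le> exp (84 * real k / h)"
        unfolding rx dist by simp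
    qed
    finally show ?thesis using yn d(1) by (simp add: y_def)
  qed
  obtain gR where gR: "strict_mono gR" "\<And>t. x + 1 * int (gR t) \<notin> B" "\<And>t. t + 1 \<le> gR t" "\<And>t. gR t \<le> t + 1 + b"
    using distances_avoiding_set[OF B(1), of b 1 x] unfolding b_def by auto
  obtain gL where gL: "strict_mono gL" "\<And>t. x + - 1 * int (gL t) \<notin> B" "\<And>t. t + 1 \<le> gL t" "\<And>t. gL t \<le> t + 1 + b"
    using distances_avoiding_set[OF B(1), of b "- 1" x] unfolding b_def by auto
  define G where "G = (\<Prod>j<m. 1 + (real b / real s) / real (Suc j))"
  have "real s * (w x * \<bar>poly Q x\<bar>) \<le> 2 * real m * G\<^sup>2 * exp (84 * real k / h) * S"
    unfolding S_def G_def
  proof (rule averaged_two_sided_bound[OF s(3) m(1) _ gR(1,3,4) gL(1,3,4)])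
    fix r assume r: "r < m * s"
    have "gR r \<le> m * s + b" "gL r \<le> m * s + b" using r gR(4)[of r] gL(4)[of r] by linarith+
    then show "x + int (gR r) \<in> {0..int n} - B \<and> w x \<le> exp (84 * real k / h) * w (x + int (gR r))"
      "x - int (gL r) \<in> {0..int n} - B \<and> w x \<le> exp (84 * real k / h) * w (x - int (gL r))"
      using near[of 1 "gR r"] near[of "- 1" "gL r"] gR(2)[of r] gL(2)[of r] by simp_all
  qed (use deg m w_nonneg in auto)
  also have "\<dots> \<le> 2 * real k * exp (12 * real k / h) * exp (84 * real k / h) * S"
  proof -
    have b1: "real b / real s \<le> 4 * real k / h\<^sup>2"
    proof -
      have "real b / real s \<le> (2 * real k * h) / (h ^ 3 / 2)"
        using B s hp unfolding b_def by (intro frac_le) auto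
      also have "\<dots> = 4 * real k / h\<^sup>2" using hp by (simp add: field_simps eval_nat_numeral)
      finally show ?thesis .
    qed
    have "2 * (real b / real s) * real m \<le> 2 * (4 * real k / h\<^sup>2) * real k"
      using b1 m by (intro mult_mono) auto
    also have "\<dots> \<le> (3 * real k / h)\<^sup>2" using hp by (simp add: power2_eq_square field_simps)
    finally have "sqrt (2 * (real b / real s) * real m) \<le> 3 * real k / h"
      using hp by (intro real_le_lsqrt) auto
    then have "G \<le> exp (6 * real k / h)"
      unfolding G_def by (intro order_trans[OF prod_one_plus_inverse_le_exp]) auto
    moreover have "G \<ge> 0" unfolding G_def by (intro prod_nonneg) auto
    ultimately have "G\<^sup>2 \<le> (exp (6 * real k / h))\<^sup>2" by (intro power_mono) auto
    also have "\<dots> = exp (12 * real k / h)" by (simp add: power2_eq_square exp_add[symmetric])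
    finally show ?thesis using m S0 by (intro mult_right_mono mult_mono) auto
  qed
  also have "\<dots> = 2 * real k * exp (96 * real k / h) * S"
    by (simp add: mult_exp_exp add_divide_distrib[symmetric])
  finally have "real s * (w x * \<bar>poly Q x\<bar>) \<le> 2 * real k * exp (96 * real k / h) * S" .
  moreover have "h ^ 3 / 2 * (w x * \<bar>poly Q x\<bar>) \<le> real s * (w x * \<bar>poly Q x\<bar>)"
    using s(2) w_nonneg by (intro mult_right_mono) auto
  ultimately show ?thesis by (simp add: S_def)
qed

text \<open>
Beyond distance \<open>20 k h\<^sup>4\<close> the weights grow by at least \<open>exp (8 / h\<^sup>4)\<close> per step towards the mean as long as the
distance exceeds \<open>16 k h\<^sup>4\<close>. All nodes are between \<open>k h\<^sup>4 / 2\<close> and \<open>4 k h\<^sup>4\<close> steps away, which gives a factor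
of at least \<open>exp (4 k) \<ge> (8 e) ^ k\<close>.
\<close>

lemma tail_point_bound:
  fixes Q :: "real poly" and B :: "int set" and x :: int
  assumes deg: "degree Q \<le> k" and B: "finite B" "real (card B) \<le> 2 * real k * h"
    and x: "0 \<le> x" "x \<le> int n" "\<bar>x - real n * p\<bar> > 20 * real k * h ^ 4"
  shows "h ^ 4 / 2 * (w x * \<bar>poly Q x\<bar>) \<le> (\<Sum>y\<in>{0..int n} - B. w y * \<bar>poly Q y\<bar>)"
proof -
  define b where "b = card B"
  define s where "s = nat \<lfloor>h ^ 4\<rfloor>"
  define U where "U = 16 * real k * h ^ 4"
  define v where "v = real n * p * (1 - p)"
  have k0: "real k \<ge> 2" using k by simp
  have hp: "h > 0" using h by simp
  have s: "real s \<le> h ^ 4" "h ^ 4 / 2 \<le> real s" "s \<ge> 1"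
    using h_bounds(1) unfolding s_def by linarith+
  have v_eq: "v = real k * h ^ 8" using scale by (simp add: v_def)
  have v0: "v > 0" using k0 hp by (simp add: v_eq)
  have U: "0 \<le> U" "U \<le> v" "U > 0"
  proof -
    have "16 * (real k * h ^ 4) \<le> h ^ 4 * (real k * h ^ 4)"
      using h_bounds(1) hp by (intro mult_right_mono) auto
    also have "\<dots> = v" by (simp add: v_eq eval_nat_numeral)
    finally show "U \<le> v" by (simp add: U_def)
  qed (use hp k0 in \<open>simp_all add: U_def\<close>)
  have Uv: "U / (2 * v) = 8 / h ^ 4"
    using k0 hp by (simp add: U_def v_eq field_simps flip: power_add)
  have bks: "b \<le> k * s"
  proof -
    have "real b \<le> real k * (2 * h)" using B by (simp add: b_def algebra_simps)
    also have "\<dots> \<le> real k * real s" using h_bounds(4) s by (intro mult_left_mono) auto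
    finally have "real b \<le> real (k * s)" by simp
    then show ?thesis by (simp only: of_nat_le_iff)
  qed
  \<comment> \<open>the direction from \<open>x\<close> towards the mean\<close>
  define e :: int where "e = (if x > real n * p then - 1 else 1)"
  have e: "e = 1 \<or> e = - 1" by (simp add: e_def)
  obtain g where g: "strict_mono g" "\<And>t. x + e * int (g t) \<notin> B" "\<And>t. t + 1 \<le> g t" "\<And>t. g t \<le> t + 1 + b"
    using distances_avoiding_set[OF B(1) _ e, of b x] unfolding b_def by auto
  have e8: "(8 * exp 1) ^ k \<le> exp (4 * real k)"
  proof -
    have "(2::real) ^ 3 \<le> exp 1 ^ 3"
      using exp_ge_add_one_self[of 1] by (intro power_mono) auto
    then have "8 * exp 1 \<le> exp 1 ^ 3 * exp (1::real)" by (intro mult_right_mono) auto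
    also have "\<dots> = exp 4" by (simp add: exp_of_nat_mult[symmetric] mult_exp_exp)
    finally have "(8 * exp 1) ^ k \<le> exp (4::real) ^ k" by (intro power_mono) auto
    then show ?thesis by (simp add: exp_of_nat_mult[symmetric] mult.commute)
  qed
  have main: "x + e * int d \<in> {0..int n} - B \<and> (8 * exp 1) ^ k * w x \<le> w (x + e * int d)"
    if d: "x + e * int d \<notin> B" "k * s \<le> d" "d \<le> (2 * k + 1) * s + b" for d
  proof -
    have "d \<le> (2 * k + 1) * s + k * s" using d(3) bks by linarith
    also have "\<dots> = (3 * k + 1) * s" by (simp add: algebra_simps)
    also have "\<dots> \<le> 4 * k * s" using k by (intro mult_right_mono) auto
    finally have "real d \<le> real (4 * k * s)" by (simp only: of_nat_le_iff)
    also have "\<dots> \<le> 4 * real k * h ^ 4" using s by (simp add: mult_left_mono)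
    finally have d1: "real d \<le> 4 * real k * h ^ 4" .
    have "real k * (h ^ 4 / 2) \<le> real k * real s" using s by (intro mult_left_mono) auto
    also have "\<dots> \<le> real d" using d(2) by (metis of_nat_le_iff of_nat_mult)
    finally have d2: "real k * (h ^ 4 / 2) \<le> real d" .
    have ex: "exp (4 * real k) * exp (- U / (2 * v) * real d) \<le> 1"
    proof -
      have "4 * real k = 8 / h ^ 4 * (real k * (h ^ 4 / 2))" using hp by simp
      also have "\<dots> \<le> 8 / h ^ 4 * real d" using d2 hp by (intro mult_left_mono) auto
      also have "\<dots> = U / (2 * v) * real d" by (simp only: Uv)
      finally show ?thesis by (simp add: mult_exp_exp)
    qed
    define y where "y = x + e * int d"
    have y: "0 \<le> y \<and> y \<le> int n \<and> w x \<le> exp (- U / (2 * v) * real d) * w y"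
    proof (cases "x > real n * p")
      case True
      then have ye: "y = x - int d" by (simp add: y_def e_def)
      have far: "U \<le> real_of_int y - real n * p"
        using True x(3) d1 unfolding ye U_def by simp
      moreover have "0 \<le> real n * p" using p by simp
      ultimately have "0 \<le> real_of_int y" using U by linarith
      then have y0: "0 \<le> y" by simp
      have ny: "nat x = nat y + d" using y0 ye by simp
      have "w x \<le> exp (- U / (2 * v) * real d) * w y"
        unfolding w_def ny using far y0 x ny
        by (intro binom_weight_tail_ratio(1)[OF p v_def v0 U(1,2)]) auto
      then show ?thesis using y0 ye x by simp
    next
      case False
      then have ye: "y = x + int d" by (simp add: y_def e_def)
      have far: "real_of_int y - real n * p \<le> - U"
        using False x(3) d1 unfolding ye U_def by simp
      moreover have "real n * p \<le> real n" using p by (simp add: mult_left_le)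
      ultimately have "real_of_int y \<le> real n" using U by linarith
      then have y0: "y \<le> int n" by simp
      have ny: "nat y = nat x + d" using x ye by simp
      have "real (nat y) = real_of_int y" using x ye by simp
      then have "w x \<le> exp (- U / (2 * v) * real d) * w y"
        unfolding w_def ny using far y0 x ny
        by (intro binom_weight_tail_ratio(2)[OF p v_def v0 U(1,2)]) auto
      then show ?thesis using y0 ye x by simp
    qed
    have "(8 * exp 1) ^ k * w x \<le> exp (4 * real k) * (exp (- U / (2 * v) * real d) * w y)"
      using e8 y w_nonneg by (intro mult_mono) auto
    also have "\<dots> \<le> 1 * w y"
      using ex w_nonneg unfolding mult.assoc[symmetric] by (rule mult_right_mono)
    finally show ?thesis using y d(1) by (simp add: y_def)
  qed
  have "real s * (w x * \<bar>poly Q x\<bar>) \<le> (\<Sum>y\<in>{0..int n} - B. w y * \<bar>poly Q y\<bar>)"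
  proof (rule averaged_one_sided_bound[OF s(3) k deg e g(1,4) bks])
    fix r assume r: "k * s \<le> r" "r < (2 * k + 1) * s"
    show "x + e * int (g r) \<in> {0..int n} - B \<and> (8 * exp 1) ^ k * w x \<le> w (x + e * int (g r))"
      using r g(3)[of r] g(4)[of r] by (intro main g(2)) linarith+
  qed (use w_nonneg in auto)
  moreover have "h ^ 4 / 2 * (w x * \<bar>poly Q x\<bar>) \<le> real s * (w x * \<bar>poly Q x\<bar>)"
    using s(2) w_nonneg by (intro mult_right_mono) auto
  ultimately show ?thesis by linarith
qed

text \<open>
Each of the at most \<open>2 k h\<close> points of \<open>B\<close> contributes at most \<open>O(k exp (96 k / h) / h\<^sup>3)\<close> times the sum over the
complement. Thanks to the division by \<open>h\<^sup>3\<close>, which the averaging produced, the number of points only costs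
a factor of order \<open>k / h\<^sup>2\<close>, which is at most \<open>exp (k / h)\<close>.
\<close>

lemma binomial_remez:
  fixes Q :: "real poly" and B :: "int set"
  assumes deg: "degree Q \<le> k" and B: "finite B" "real (card B) \<le> 2 * real k * h"
  shows "(\<Sum>y\<in>{0..int n}. w y * \<bar>poly Q y\<bar>)
    \<le> 9 * real k * exp (97 * real k / h) * (\<Sum>y\<in>{0..int n} - B. w y * \<bar>poly Q y\<bar>)"
proof -
  define S where "S = (\<Sum>y\<in>{0..int n} - B. w y * \<bar>poly Q y\<bar>)"
  have S0: "S \<ge> 0" unfolding S_def using w_nonneg by (intro sum_nonneg) auto
  have k0: "real k \<ge> 2" using k by simp
  have hp: "h > 0" "h \<ge> 1" using h by auto
  define E where "E = exp (96 * real k / h)"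
  have E1: "E \<ge> 1" using hp by (simp add: E_def)
  have pt: "w x * \<bar>poly Q x\<bar> \<le> 4 * real k / h ^ 3 * E * S" if x: "x \<in> {0..int n} \<inter> B" for x
  proof -
    have "h ^ 3 / 2 * (w x * \<bar>poly Q x\<bar>) \<le> 2 * real k * E * S"
    proof (cases "\<bar>x - real n * p\<bar> \<le> 20 * real k * h ^ 4")
      case True
      then show ?thesis using bulk_point_bound[OF deg B _ _ True] x by (simp add: S_def E_def)
    next
      case False
      have "h ^ 3 \<le> h ^ 4" using hp by (intro power_increasing) auto
      then have "h ^ 3 / 2 * (w x * \<bar>poly Q x\<bar>) \<le> h ^ 4 / 2 * (w x * \<bar>poly Q x\<bar>)"
        using w_nonneg by (intro mult_right_mono) auto
      also have "\<dots> \<le> S" using tail_point_bound[OF deg B, of x] False x by (simp add: S_def)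
      also have "1 * S \<le> (2 * real k * E) * S"
        using k0 E1 S0 mult_mono[of 1 "2 * real k" 1 E] by (intro mult_right_mono) auto
      finally show ?thesis by simp
    qed
    then show ?thesis using hp by (simp add: field_simps)
  qed
  have "(\<Sum>y\<in>{0..int n} \<inter> B. w y * \<bar>poly Q y\<bar>) \<le> (\<Sum>y\<in>{0..int n} \<inter> B. 4 * real k / h ^ 3 * E * S)"
    by (intro sum_mono pt)
  also have "\<dots> = real (card ({0..int n} \<inter> B)) * (4 * real k / h ^ 3 * E * S)" by simp
  also have "\<dots> \<le> 2 * real k * h * (4 * real k / h ^ 3 * E * S)"
  proof (rule mult_right_mono)
    have "card ({0..int n} \<inter> B) \<le> card B" using B by (intro card_mono) auto
    then show "real (card ({0..int n} \<inter> B)) \<le> 2 * real k * h" using B(2) by linarith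
  qed (use S0 E1 hp in auto)
  also have "\<dots> = 8 * real k * E * (real k / h\<^sup>2) * S"
    using hp by (simp add: field_simps eval_nat_numeral)
  also have "\<dots> \<le> 8 * real k * E * exp (real k / h) * S"
  proof -
    have "real k / h\<^sup>2 \<le> real k / h"
      using hp by (intro divide_left_mono) (auto simp: power2_eq_square)
    also have "\<dots> \<le> exp (real k / h)" using exp_ge_add_one_self[of "real k / h"] by linarith
    finally show ?thesis using E1 S0 by (intro mult_right_mono mult_left_mono) auto
  qed
  also have "\<dots> = 8 * real k * exp (97 * real k / h) * S"
    by (simp add: E_def mult_exp_exp add_divide_distrib[symmetric])
  finally have "(\<Sum>y\<in>{0..int n} \<inter> B. w y * \<bar>poly Q y\<bar>) \<le> 8 * real k * exp (97 * real k / h) * S" .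
  moreover have "(\<Sum>y\<in>{0..int n}. w y * \<bar>poly Q y\<bar>) = (\<Sum>y\<in>{0..int n} \<inter> B. w y * \<bar>poly Q y\<bar>) + S"
    unfolding S_def by (subst sum.Int_Diff[of _ _ B]) auto
  moreover have "1 * S \<le> (real k * exp (97 * real k / h)) * S"
    using k0 hp S0 mult_mono[of 1 "real k" 1 "exp (97 * real k / h)"] by (intro mult_right_mono) auto
  ultimately show ?thesis unfolding S_def[symmetric] by (simp add: algebra_simps)
qed

end

section \<open>Merging pairs of roots\<close>

lemma card_ints_near:
  fixes z h :: real
  assumes "h > 0"
  shows "finite {y::int. \<bar>y - z\<bar> < h}" "real (card {y::int. \<bar>y - z\<bar> < h}) \<le> 2 * h + 1"
proof -
  have sub: "{y::int. \<bar>y - z\<bar> < h} \<subseteq> {\<lceil>z - h\<rceil>..\<lfloor>z + h\<rfloor>}" by (auto simp: ceiling_le_iff le_floor_iff)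
  then show "finite {y::int. \<bar>y - z\<bar> < h}" by (rule finite_subset) simp
  have "card {y::int. \<bar>y - z\<bar> < h} \<le> card {\<lceil>z - h\<rceil>..\<lfloor>z + h\<rfloor>}" using sub by (intro card_mono) auto
  also have "\<dots> = nat (\<lfloor>z + h\<rfloor> - \<lceil>z - h\<rceil> + 1)" by simp
  finally show "real (card {y::int. \<bar>y - z\<bar> < h}) \<le> 2 * h + 1" using assms by linarith
qed

text \<open>
At distance at least \<open>h\<close> from the midpoint, the term \<open>d\<^sup>2 \<le> 1 / 4\<close> is at most a fraction \<open>1 / (4 h\<^sup>2)\<close> of \<open>t\<^sup>2\<close>.
\<close>

lemma merged_root_pair_bound:
  fixes t d h :: real
  assumes h: "h \<ge> 1" and d: "0 \<le> d" "d \<le> 1 / 2" and t: "\<bar>t\<bar> \<ge> h"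
  shows "t\<^sup>2 \<le> exp (1 / (2 * h\<^sup>2)) * (t\<^sup>2 - d\<^sup>2)"
proof -
  define u where "u = 1 / (4 * h\<^sup>2)"
  have h2: "h\<^sup>2 \<ge> 1" using h by simp
  have u: "0 \<le> u" "u \<le> 1 / 4" using h2 by (auto simp: u_def divide_simps)
  have ht: "h\<^sup>2 \<le> t\<^sup>2" using power_mono[OF t, of 2] h by simp
  have "d\<^sup>2 \<le> (1 / 2)\<^sup>2" using d by (intro power_mono) auto
  also have "\<dots> = u * h\<^sup>2" using h by (simp add: u_def power2_eq_square)
  also have "\<dots> \<le> u * t\<^sup>2" using ht u by (intro mult_left_mono) auto
  finally have "(1 - u) * t\<^sup>2 \<le> t\<^sup>2 - d\<^sup>2" by (simp add: algebra_simps)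
  moreover have "1 \<le> exp (2 * u) * (1 - u)"
  proof -
    have "u * u \<le> u * (1 / 4)" using u by (intro mult_left_mono) auto
    then have "1 \<le> (1 + 2 * u) * (1 - u)" using u by (simp add: algebra_simps)
    also have "\<dots> \<le> exp (2 * u) * (1 - u)" using u by (intro mult_right_mono exp_ge_add_one_self) auto
    finally show ?thesis .
  qed
  then have "1 * t\<^sup>2 \<le> (exp (2 * u) * (1 - u)) * t\<^sup>2" by (rule mult_right_mono) simp
  then have "t\<^sup>2 \<le> exp (2 * u) * ((1 - u) * t\<^sup>2)" by (simp only: mult_1 mult.assoc)
  ultimately have "t\<^sup>2 \<le> exp (2 * u) * (t\<^sup>2 - d\<^sup>2)"
    by (meson exp_ge_zero mult_left_mono order_trans)
  then show ?thesis by (simp add: u_def)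
qed

lemma poly_root_pairs: "poly (\<Prod>(z, d)\<leftarrow>zs. [:- (z - d), 1:] * [:- (z + d), 1:]) x = (\<Prod>(z, d)\<leftarrow>zs. (x - z)\<^sup>2 - d\<^sup>2 :: real)"
  by (induction zs) (auto simp: power2_eq_square algebra_simps)

lemma poly_double_roots: "poly (\<Prod>(z, d)\<leftarrow>zs. [:- z, 1:] ^ 2) x = (\<Prod>(z, d)\<leftarrow>zs. (x - z)\<^sup>2 :: real)"
  by (induction zs) (auto simp: power2_eq_square algebra_simps)

lemma degree_double_roots: "degree (\<Prod>(z, d::real)\<leftarrow>zs. [:- z :: real, 1:] ^ 2) \<le> 2 * length zs"
proof (induction zs)
  case (Cons a zs)
  have "degree ([:- fst a, 1:] ^ 2) \<le> 2" by (rule order_trans[OF degree_power_le]) simp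
  then show ?case using Cons by (auto simp: case_prod_beta intro!: order_trans[OF degree_mult_le])
qed simp

lemma prod_list_le_power_mult:
  fixes f g :: "'a \<Rightarrow> real"
  assumes "\<And>a. a \<in> set zs \<Longrightarrow> 0 \<le> f a \<and> f a \<le> c * g a" "c \<ge> 0"
  shows "0 \<le> prod_list (map f zs) \<and> prod_list (map f zs) \<le> c ^ length zs * prod_list (map g zs)"
  using assms(1)
proof (induction zs)
  case (Cons a zs)
  then have IH: "0 \<le> prod_list (map f zs)" "prod_list (map f zs) \<le> c ^ length zs * prod_list (map g zs)"
    and a: "0 \<le> f a" "f a \<le> c * g a" by auto
  have "f a * prod_list (map f zs) \<le> (c * g a) * (c ^ length zs * prod_list (map g zs))"
    using a IH by (intro mult_mono) auto
  then show ?case using a IH by (simp add: mult_ac)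
qed simp

context binomial_scale
begin

text \<open>
The polynomial \<open>Q\<close> replaces every pair of roots of \<open>P\<close> by a double root at the midpoint. Off the integers near a
midpoint \<open>Q\<close> is at most \<open>exp (k / h) P\<close>, and \<open>binomial_remez\<close> says that these integers carry enough of \<open>E Q\<close>.
\<close>

lemma nonneg_on_interval_perturbation:
  fixes P :: "real poly"
  assumes deg: "degree P \<le> k" and nonneg: "\<And>j. j \<le> n \<Longrightarrow> 0 \<le> poly P (real j)" and P0: "P \<noteq> 0"
  obtains Q where "degree Q \<le> k" "\<And>x. 0 \<le> x \<Longrightarrow> x \<le> real n \<Longrightarrow> 0 \<le> poly Q x"
    "poly P (real n) \<le> poly Q (real n)"
    "(\<Sum>j\<le>n. binom_weight n p j * poly Q (real j))
      \<le> 9 * real k * exp (98 * real k / h) * (\<Sum>j\<le>n. binom_weight n p j * poly P (real j))"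
proof -
  obtain R zs where fac: "P = R * (\<Prod>(z, d)\<leftarrow>zs. [:- (z - d), 1:] * [:- (z + d), 1:])"
    and len: "degree R + 2 * length zs = degree P"
    and R': "\<forall>x\<in>{0..real n}. 0 \<le> poly R x"
    and zs': "\<forall>(z, d)\<in>set zs. 0 \<le> d \<and> d \<le> 1 / 2 \<and> (\<forall>j\<le>n. 0 \<le> (real j - z)\<^sup>2 - d\<^sup>2)"
    by (rule exE[OF nonneg_on_integers_factorization[of P n, OF P0]], erule nonneg, elim exE conjE, rule that)
  have R: "0 \<le> poly R x" if "0 \<le> x" "x \<le> real n" for x using R' that by simp
  have zs: "0 \<le> d \<and> d \<le> 1 / 2" "j \<le> n \<Longrightarrow> 0 \<le> (real j - z)\<^sup>2 - d\<^sup>2" if "(z, d) \<in> set zs" for z d j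
    using bspec[OF zs' that] by simp_all
  define Q where "Q = R * (\<Prod>(z, d)\<leftarrow>zs. [:- z, 1:] ^ 2)"
  define B where "B = (\<Union>(z, d)\<in>set zs. {y::int. \<bar>y - z\<bar> < h})"
  have hp: "h > 0" "h \<ge> 1" using h by auto
  have k0: "real k \<ge> 2" using k by simp
  have degQ: "degree Q \<le> k"
  proof -
    have "degree Q \<le> degree R + 2 * length zs"
      unfolding Q_def by (rule order_trans[OF degree_mult_le add_left_mono[OF degree_double_roots]])
    then show ?thesis using len deg by linarith
  qed
  have polyP: "poly P x = poly R x * (\<Prod>(z, d)\<leftarrow>zs. (x - z)\<^sup>2 - d\<^sup>2)" for x
    unfolding fac poly_mult poly_root_pairs ..
  have polyQ: "poly Q x = poly R x * (\<Prod>(z, d)\<leftarrow>zs. (x - z)\<^sup>2)" for x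
    unfolding Q_def poly_mult poly_double_roots ..
  have sq0: "0 \<le> (\<Prod>(z, d)\<leftarrow>zs. (x - z)\<^sup>2)" for x
    by (intro prod_list_nonneg) auto
  have Q0: "0 \<le> poly Q x" if "0 \<le> x" "x \<le> real n" for x
    unfolding polyQ using R[OF that] sq0 by (intro mult_nonneg_nonneg) auto
  have end_le: "poly P (real n) \<le> poly Q (real n)"
    unfolding polyP polyQ
    using prod_list_le_power_mult[of zs "\<lambda>(z, d). (real n - z)\<^sup>2 - d\<^sup>2" 1 "\<lambda>(z, d). (real n - z)\<^sup>2"] zs(2) R[of "real n"]
    by (intro mult_left_mono) (auto simp: case_prod_beta)
  have len2: "2 * real (length zs) \<le> real k" using len deg by linarith
  have finB: "finite B" unfolding B_def using card_ints_near(1)[OF hp(1)] by auto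
  have cardB: "real (card B) \<le> 2 * real k * h"
  proof -
    have "card B \<le> (\<Sum>a\<in>set zs. card {y::int. \<bar>y - fst a\<bar> < h})"
      unfolding B_def case_prod_beta by (rule card_UN_le) simp
    then have "real (card B) \<le> (\<Sum>a\<in>set zs. real (card {y::int. \<bar>y - fst a\<bar> < h}))"
      by (metis of_nat_le_iff of_nat_sum)
    also have "\<dots> \<le> (\<Sum>a\<in>set zs. 2 * h + 1)" by (intro sum_mono card_ints_near(2)[OF hp(1)])
    also have "\<dots> = real (card (set zs)) * (2 * h + 1)" by simp
    also have "\<dots> \<le> real (length zs) * (4 * h)"
      using card_length[of zs] hp by (intro mult_mono) auto
    also have "\<dots> = 2 * real (length zs) * (2 * h)" by simp
    also have "\<dots> \<le> real k * (2 * h)" using len2 hp by (intro mult_right_mono) auto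
    finally show ?thesis by simp
  qed
  have off: "poly Q (real j) \<le> exp (real k / h) * poly P (real j)" if j: "j \<le> n" "int j \<notin> B" for j
  proof -
    define c where "c = exp (1 / (2 * h\<^sup>2))"
    have "(\<Prod>(z, d)\<leftarrow>zs. (real j - z)\<^sup>2) \<le> c ^ length zs * (\<Prod>(z, d)\<leftarrow>zs. (real j - z)\<^sup>2 - d\<^sup>2)"
    proof (rule prod_list_le_power_mult[THEN conjunct2])
      fix a assume a: "a \<in> set zs"
      obtain z d where zd: "a = (z, d)" by (cases a)
      have "h \<le> \<bar>real j - z\<bar>" using j(2) a zd by (force simp: B_def not_less)
      then have "(real j - z)\<^sup>2 \<le> c * ((real j - z)\<^sup>2 - d\<^sup>2)"
        unfolding c_def using zs(1)[of z d] a zd hp by (intro merged_root_pair_bound) auto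
      then show "0 \<le> (case a of (z, d) \<Rightarrow> (real j - z)\<^sup>2) \<and>
          (case a of (z, d) \<Rightarrow> (real j - z)\<^sup>2) \<le> c * (case a of (z, d) \<Rightarrow> (real j - z)\<^sup>2 - d\<^sup>2)"
        by (simp add: zd)
    qed (simp add: c_def)
    then have "poly Q (real j) \<le> c ^ length zs * poly P (real j)"
      unfolding polyP polyQ using mult_left_mono[OF _ R[of "real j"]] j by (fastforce simp: mult_ac)
    also have "\<dots> \<le> exp (real k / h) * poly P (real j)"
    proof (rule mult_right_mono)
      have "real (length zs) * (1 / (2 * h\<^sup>2)) \<le> real k * (1 / h)"
        using len2 hp by (intro mult_mono divide_left_mono) (auto simp: power2_eq_square)
      then show "c ^ length zs \<le> exp (real k / h)" by (simp add: c_def exp_of_nat_mult[symmetric])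
    qed (use nonneg j in auto)
    finally show ?thesis .
  qed
  have to_int: "(\<Sum>j\<le>n. binom_weight n p j * f (real j)) = (\<Sum>y\<in>{0..int n}. w y * f (real_of_int y))" for f :: "real \<Rightarrow> real"
    by (rule sum.reindex_bij_witness[of _ nat int]) (auto simp: w_def)
  have "(\<Sum>j\<le>n. binom_weight n p j * poly Q (real j)) = (\<Sum>y\<in>{0..int n}. w y * \<bar>poly Q y\<bar>)"
    unfolding to_int using Q0 by (intro sum.cong) auto
  also have "\<dots> \<le> 9 * real k * exp (97 * real k / h) * (\<Sum>y\<in>{0..int n} - B. w y * \<bar>poly Q y\<bar>)"
    by (rule binomial_remez[OF degQ finB cardB])
  also have "\<dots> \<le> 9 * real k * exp (97 * real k / h) * (\<Sum>y\<in>{0..int n}. exp (real k / h) * (w y * poly P y))"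
  proof (rule mult_left_mono)
    have nonneg': "0 \<le> poly P (real_of_int y)" if "y \<in> {0..int n}" for y
      using nonneg[of "nat y"] that by auto
    have "(\<Sum>y\<in>{0..int n} - B. w y * \<bar>poly Q y\<bar>) \<le> (\<Sum>y\<in>{0..int n} - B. exp (real k / h) * (w y * poly P y))"
    proof (rule sum_mono)
      fix y assume y: "y \<in> {0..int n} - B"
      then have "poly Q y \<le> exp (real k / h) * poly P y" using off[of "nat y"] by auto
      moreover have "\<bar>poly Q y\<bar> = poly Q y" using Q0[of y] y by simp
      ultimately show "w y * \<bar>poly Q y\<bar> \<le> exp (real k / h) * (w y * poly P y)"
        using mult_left_mono[OF _ w_nonneg[of y]] by (fastforce simp: mult_ac)
    qed
    also have "\<dots> \<le> (\<Sum>y\<in>{0..int n}. exp (real k / h) * (w y * poly P y))"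
      using w_nonneg nonneg' by (intro sum_mono2) auto
    finally show "(\<Sum>y\<in>{0..int n} - B. w y * \<bar>poly Q y\<bar>) \<le> (\<Sum>y\<in>{0..int n}. exp (real k / h) * (w y * poly P y))" .
  qed (use k0 in simp)
  also have "\<dots> = 9 * real k * (exp (97 * real k / h) * exp (real k / h)) * (\<Sum>j\<le>n. binom_weight n p j * poly P (real j))"
    unfolding to_int sum_distrib_left[symmetric] by simp
  also have "exp (97 * real k / h) * exp (real k / h) = exp (98 * real k / h)"
    by (simp add: mult_exp_exp add_divide_distrib[symmetric])
  finally show ?thesis using that[OF degQ Q0 end_le] by blast
qed

lemma M_tilde_nonneg: "0 \<le> M_tilde n k p"
  using M_tilde_attained[OF p, of n k] measure_nonneg by metis

lemma M_ge_scaled_M_tilde: "M_tilde n k p / (9 * real k * exp (98 * real k / h)) \<le> M n k p"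
proof (rule M_ge_if_dual_bound[OF p])
  define K where "K = 9 * real k * exp (98 * real k / h)"
  have K: "K > 0" using k by (simp add: K_def)
  show "0 \<le> M_tilde n k p / (9 * real k * exp (98 * real k / h))"
    using M_tilde_nonneg K by (simp add: K_def)
  fix P :: "real poly"
  assume P: "degree P \<le> k" "\<And>j. j \<le> n \<Longrightarrow> 0 \<le> poly P (real j)"
  have "M_tilde n k p * poly P (real n) \<le> K * (\<Sum>j\<le>n. binom_weight n p j * poly P (real j))"
  proof (cases "P = 0")
    case False
    obtain Q where Q: "degree Q \<le> k" "\<And>x. 0 \<le> x \<Longrightarrow> x \<le> real n \<Longrightarrow> 0 \<le> poly Q x"
      "poly P (real n) \<le> poly Q (real n)"
      "(\<Sum>j\<le>n. binom_weight n p j * poly Q (real j)) \<le> K * (\<Sum>j\<le>n. binom_weight n p j * poly P (real j))"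
      by (rule nonneg_on_interval_perturbation[OF P False, folded K_def]) (assumption, rule that, blast+)
    have "M_tilde n k p * poly P (real n) \<le> M_tilde n k p * poly Q (real n)"
      using Q(3) M_tilde_nonneg by (rule mult_left_mono)
    also have "\<dots> \<le> (\<Sum>j\<le>n. binom_weight n p j * poly Q (real j))"
      by (rule M_tilde_mult_le_expectation[OF p Q(1,2)])
    finally show ?thesis using Q(4) by linarith
  qed simp
  then show "M_tilde n k p / (9 * real k * exp (98 * real k / h)) * poly P (real n)
      \<le> (\<Sum>j\<le>n. binom_weight n p j * poly P (real j))"
    using K unfolding K_def[symmetric] by (simp add: field_simps)
qed

end

section \<open>The lower bound for the maximal probability\<close>

text \<open>
With \<open>t = ln a\<close> the claim is \<open>64 ln t \<le> t\<close>. Since \<open>ln t \<le> 2 sqrt t\<close>, it holds once \<open>sqrt t \<ge> 128\<close>.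
\<close>

lemma V_le_powr:
  assumes "a \<ge> exp 16384"
  shows "V a \<le> a powr (1 / 8)"
proof -
  define t where "t = ln a"
  have a0: "a > 0" using assms by (rule less_le_trans[OF exp_gt_zero])
  have t: "t \<ge> 16384" using assms a0 by (simp add: t_def ln_ge_iff)
  have "ln t = 2 * ln (sqrt t)" using t by (simp add: ln_sqrt)
  also have "\<dots> \<le> 2 * sqrt t" using ln_bound[of "sqrt t"] t by simp
  also have "\<dots> \<le> t / 64"
  proof -
    have "128 \<le> sqrt t" using t by (intro real_le_rsqrt) auto
    then have "128 * sqrt t \<le> sqrt t * sqrt t" using t by (intro mult_right_mono) auto
    then show ?thesis using t by simp
  qed
  finally have "t * ln t \<le> t * (t / 64)" using t by (intro mult_left_mono) auto
  also have "\<dots> = (t / 8)\<^sup>2" by (simp add: power2_eq_square)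
  finally have "sqrt (t * ln t) \<le> t / 8" using t by (intro real_le_lsqrt) auto
  then show ?thesis using a0 by (simp add: V_def t_def powr_def)
qed

theorem theorem1p1:
  shows "\<exists>c1 c2 c3 :: real. c1 > 0 \<and> c2 > 0 \<and> c3 > 0 \<and>
    (\<forall>(n::nat) (k::nat) (p::real). n \<ge> 1 \<longrightarrow> k \<ge> 1 \<longrightarrow> even k \<longrightarrow> 0 < p \<longrightarrow> p < 1 \<longrightarrow>
      (let N = real n * p * (1 - p) - 1 in
        real k \<le> c1 * N \<longrightarrow>
        M n k p \<ge> c3 / real k * exp (- c2 * (real k / V (N / real k))) * M_tilde n k p))"
proof (rule exI[of _ "exp (- 16384)"], rule exI[of _ 98], rule exI[of _ "1 / 9"], intro conjI allI impI)
  fix n k :: nat and p :: real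
  assume *: "n \<ge> 1" "k \<ge> 1" "even k" "0 < p" "p < 1"
  show "let N = real n * p * (1 - p) - 1 in
        real k \<le> exp (- 16384) * N \<longrightarrow>
        M n k p \<ge> 1 / 9 / real k * exp (- 98 * (real k / V (N / real k))) * M_tilde n k p"
    unfolding Let_def
  proof
    define v where "v = real n * p * (1 - p)"
    define a where "a = (v - 1) / real k"
    define h where "h = (v / real k) powr (1 / 8)"
    assume "real k \<le> exp (- 16384) * (real n * p * (1 - p) - 1)"
    then have kN: "real k * exp 16384 \<le> v - 1" by (simp add: v_def exp_minus field_simps)
    have k0: "real k > 0" using * by simp
    have a: "exp 16384 \<le> a" using kN k0 by (simp add: a_def field_simps)
    have av: "a \<le> v / real k" using k0 by (simp add: a_def divide_right_mono)
    have a0: "a > 0" using a by (rule less_le_trans[OF exp_gt_zero])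
    have Vh: "V a \<le> h"
      unfolding h_def using V_le_powr[OF a] av a0
      by (intro order_trans[OF V_le_powr[OF a]] powr_mono2) auto
    have h3: "h \<ge> 3"
    proof -
      have "(3::real) = (3 powr 8) powr (1 / 8)" by (simp add: powr_powr)
      also have "\<dots> \<le> h"
        unfolding h_def
      proof (intro powr_mono2)
        have "(3::real) powr 8 \<le> 1 + 16384" by simp
        also have "\<dots> \<le> exp 16384" by (rule exp_ge_add_one_self)
        finally show "3 powr 8 \<le> v / real k" using a av by linarith
      qed auto
      finally show ?thesis .
    qed
    have h8: "h ^ 8 = v / real k"
    proof -
      have pos: "v / real k > 0" using a0 av by linarith
      have "h ^ 8 = h powr 8" using h3 by simp
      also have "\<dots> = (v / real k) powr 1" unfolding h_def powr_powr by simp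
      also have "\<dots> = v / real k" using pos by (intro powr_one) simp
      finally show ?thesis .
    qed
    have "k \<noteq> 1" using *(3) by auto
    then interpret binomial_scale n k p h
      using * h3 h8 k0 by unfold_locales (auto simp: v_def field_simps)
    have V0: "V a > 0" by (simp add: V_def)
    have "1 / 9 / real k * exp (- 98 * (real k / V a)) * M_tilde n k p
        \<le> 1 / 9 / real k * exp (- 98 * (real k / h)) * M_tilde n k p"
    proof (intro mult_right_mono mult_left_mono M_tilde_nonneg)
      have "real k / h \<le> real k / V a" using Vh V0 k0 by (intro divide_left_mono) auto
      then show "exp (- 98 * (real k / V a)) \<le> exp (- 98 * (real k / h))" by simp
    qed simp
    also have "\<dots> = M_tilde n k p / (9 * real k * exp (98 * real k / h))"
      by (simp add: exp_minus field_simps)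
    also have "\<dots> \<le> M n k p" by (rule M_ge_scaled_M_tilde)
    finally show "M n k p \<ge> 1 / 9 / real k * exp (- 98 * (real k / V ((real n * p * (1 - p) - 1) / real k))) * M_tilde n k p"
      by (simp add: a_def v_def)
  qed
qed auto

end
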